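(* Let $H$ be a cocommutative Hopf algebra over a field $\mathbf{k}$. The collection of all $2$-term $L_\infty$ $H$-pseudoalgebras and morphisms between them forms a category (denoted $\mathbf{2shLie}H$).
   Context: Polylinear maps. $H^{\otimes n}$ is a right $H$-module via $(h_1\otimes\cdots\otimes h_n)h=h_1h_{(1)}\otimes\cdots\otimes h_nh_{(n)}$. For left $H$-modules, $\mathrm{Hom}_{H^{\otimes n}}(L_1\boxtimes\cdots\boxtimes L_n,H^{\otimes n}\otimes_HM)$ is the space of $H^{\otimes n}$-linear maps $L_1\otimes\cdots\otimes L_n\to H^{\otimes n}\otimes_HM$ ($H^{\otimes n}$ acts factorwise on the source, by left multiplication on the target); its elements are called polylinear. Composition of polylinear maps: if $\psi(y_1,\dots,y_l)=\sum_i(h_i^1\otimes\cdots\otimes h_i^l)\otimes_He_i$ and $\varphi(x_1,\dots,x_{m-1},e_i,x_{m+1},\dots,x_k)=\sum_j(f^1_{ij}\otimes\cdots\otimes f^k_{ij})\otimes_He_{ij}$, then $\varphi(x_1,\dots,x_{m-1},\psi(y_1,\dots,y_l),x_{m+1},\dots,x_k)=\sum_{i,j}(f^1_{ij}\otimes\cdots\otimes f^{m-1}_{ij}\otimes h_i^1f^m_{ij(1)}\otimes\cdots\otimes h^l_if^m_{ij(l)}\otimes f^{m+1}_{ij}\otimes\cdots\otimes f^k_{ij})\otimes_He_{ij}$. $H$-linear maps are applied to $H^{\otimes n}\otimes_HM$ through the second factor. Slot convention: each factor of $H^{\otimes N}$ is attached to one argument; in identities whose terms involve the same elements in different orders, the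 $H$-factors are permuted so that they appear in one fixed order of the elements (well defined by cocommutativity). Skew-symmetric means: under this convention, exchanging two arguments changes the sign. A $2$-term $L_\infty$ $H$-pseudoalgebra $(\mathcal{L}_1\xrightarrow{\beta_1}\mathcal{L}_0,\beta_2,\beta_3)$: left $H$-modules $\mathcal{L}_0,\mathcal{L}_1$, an $H$-linear map $\beta_1$, a skew-symmetric polylinear $\beta_2$ with components $\mathcal{L}_i\boxtimes\mathcal{L}_j\to H^{\otimes2}\otimes_H\mathcal{L}_{i+j}$ (zero on $\mathcal{L}_1\boxtimes\mathcal{L}_1$; $\beta_2(u,x)=-\beta_2(x,u)$ under the slot convention), and a skew-symmetric polylinear $\beta_3:\mathcal{L}_0^{\boxtimes3}\to H^{\otimes3}\otimes_H\mathcal{L}_1$, such that for $x,y,z,w\in\mathcal{L}_0$, $u,v\in\mathcal{L}_1$: (i) $\beta_1(\beta_2(x,u))=\beta_2(x,\beta_1(u))$; (ii) $\beta_2(\beta_1(u),v)=\beta_2(u,\beta_1(v))$; (iii) $\beta_2(\beta_2(x,y),z)-\beta_2(x,\beta_2(y,z))+\beta_2(y,\beta_2(x,z))=-\beta_1(\beta_3(x,y,z))$; (iv) $\beta_2(\beta_2(x,y),v)-\beta_2(x,\beta_2(y,v))+\beta_2(y,\beta_2(x,v))=-\beta_3(x,y,\beta_1(v))$; (v) $\beta_2(x,\beta_3(y,z,w))-\beta_2(y,\beta_3(x,z,w))+\beta_2(z,\beta_3(x,y,w))-\beta_2(w,\beta_3(x,y,z))-\beta_3(\beta_2(x,y),z,w)+\beta_3(\beta_2(x,z),y,w)-\beta_3(\beta_2(x,w),y,z)-\beta_3(\beta_2(y,z),x,w)+\beta_3(\beta_2(y,w),x,z)-\beta_3(\beta_2(z,w),x,y)=0$.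 A morphism $(f_0,f_1,f_2):\mathcal{L}\rightsquigarrow\mathcal{L}'$: $H$-linear $f_0:\mathcal{L}_0\to\mathcal{L}_0'$, $f_1:\mathcal{L}_1\to\mathcal{L}_1'$ and a polylinear map $f_2:\mathcal{L}_0\boxtimes\mathcal{L}_0\to H^{\otimes2}\otimes_H\mathcal{L}'_1$ such that for $x,y,z\in\mathcal{L}_0$, $u\in\mathcal{L}_1$: $\beta_1'\circ f_1=f_0\circ\beta_1$; $f_0(\beta_2(x,y))-\beta_2'(f_0(x),f_0(y))=\beta_1'(f_2(x,y))$; $f_1(\beta_2(x,u))-\beta_2'(f_0(x),f_1(u))=f_2(x,\beta_1(u))$; and $\beta_2'(f_2(x,y),f_0(z))-\beta_2'(f_0(x),f_2(y,z))+\beta_2'(f_0(y),f_2(x,z))+f_2(\beta_2(x,y),z)-f_2(x,\beta_2(y,z))+f_2(y,\beta_2(x,z))=\beta_3'(f_0(x),f_0(y),f_0(z))-f_1(\beta_3(x,y,z))$. The composite of $f=(f_0,f_1,f_2):\mathcal{L}\rightsquigarrow\mathcal{L}'$ and $g=(g_0,g_1,g_2):\mathcal{L}'\rightsquigarrow\mathcal{L}''$ is $$g\circ f=\big(g_0\circ f_0,\ g_1\circ f_1,\ g_2\circ(f_0\otimes f_0)+(\mathrm{id}_{H^{\otimes2}}\otimes_Hg_1)\circ f_2\big).$$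
   Formalization: The component f_2 of a morphism is required to be skew-symmetric; for merely polylinear f_2 composites can fail the last morphism identity (already for H = k). The pseudoalgebras have underlying sets in a fixed but arbitrary universe. *)

theory Defs
  imports Complex_Main "HOL-Algebra.Module" "HOL-Library.Poly_Mapping" "HOL-Library.FuncSet"
begin

section \<open>Quotients of free vector spaces\<close>

text \<open>The free vector space on a set of generators of type \<open>'x\<close> consists of finitely supported
  functions; the generator \<open>x\<close> is \<open>Poly_Mapping.single x 1\<close>.\<close>

definition fscale :: "'k::field \<Rightarrow> ('x \<Rightarrow>\<^sub>0 'k) \<Rightarrow> ('x \<Rightarrow>\<^sub>0 'k)" where
  "fscale c = Poly_Mapping.map ((*) c)"

definition lin_ext :: "('x \<Rightarrow> ('y \<Rightarrow>\<^sub>0 'k)) \<Rightarrow> ('x \<Rightarrow>\<^sub>0 'k::field) \<Rightarrow> ('y \<Rightarrow>\<^sub>0 'k)" where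
  "lin_ext F p = (\<Sum>x\<in>Poly_Mapping.keys p. fscale (Poly_Mapping.lookup p x) (F x))"

definition coset :: "('x \<Rightarrow>\<^sub>0 'k::field) set \<Rightarrow> ('x \<Rightarrow>\<^sub>0 'k) \<Rightarrow> ('x \<Rightarrow>\<^sub>0 'k) set" where
  "coset R p = {q. p - q \<in> module.span fscale R}"

definition rep :: "'a set \<Rightarrow> 'a" where
  "rep A = (SOME p. p \<in> A)"

text \<open>The group operations of a quotient, which on cosets are the elementwise ones (for sets,
  \<open>A - B\<close> already denotes the set difference).\<close>

definition cplus :: "'a::ab_group_add set \<Rightarrow> 'a set \<Rightarrow> 'a set" (infixl "\<boxplus>" 65) where
  "A \<boxplus> B = {p + q | p q. p \<in> A \<and> q \<in> B}"

definition cminus :: "'a::ab_group_add set \<Rightarrow> 'a set \<Rightarrow> 'a set" (infixl "\<boxminus>" 65) where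
  "A \<boxminus> B = {p - q | p q. p \<in> A \<and> q \<in> B}"

definition cneg :: "'a::ab_group_add set \<Rightarrow> 'a set" where
  "cneg A = uminus ` A"


section \<open>Cocommutative Hopf algebras\<close>

text \<open>The algebra \<open>H\<close> is the whole type \<open>'h\<close> with its ring structure; the record holds the
  remaining structure.  An element of \<open>H\<^sup>\<otimes>\<^sup>n\<close> is a coset of formal \<open>'k\<close>-linear combinations of lists
  of length \<open>n\<close>, the list \<open>[h\<^sub>1, \<dots>, h\<^sub>n]\<close> standing for \<open>h\<^sub>1 \<otimes> \<cdots> \<otimes> h\<^sub>n\<close>.\<close>

record (overloaded) ('k::zero, 'h) hopf =
  hscale :: "'k \<Rightarrow> 'h \<Rightarrow> 'h"
  comult :: "'h \<Rightarrow> ('h list \<Rightarrow>\<^sub>0 'k) set"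
  counit :: "'h \<Rightarrow> 'k"
  antipode :: "'h \<Rightarrow> 'h"

definition tpow_rels :: "('k::field, 'h::ring_1) hopf \<Rightarrow> nat \<Rightarrow> ('h list \<Rightarrow>\<^sub>0 'k) set" where
  "tpow_rels H n =
     {Poly_Mapping.single (a[i := u + v]) 1 - Poly_Mapping.single (a[i := u]) 1
        - Poly_Mapping.single (a[i := v]) 1 | a i u v. length a = n \<and> i < n}
   \<union> {Poly_Mapping.single (a[i := hscale H c u]) 1 - Poly_Mapping.single (a[i := u]) c
        | a i c u. length a = n \<and> i < n}"

abbreviation tpow_class :: "('k::field, 'h::ring_1) hopf \<Rightarrow> nat \<Rightarrow> ('h list \<Rightarrow>\<^sub>0 'k) \<Rightarrow> ('h list \<Rightarrow>\<^sub>0 'k) set" where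
  "tpow_class H n \<equiv> coset (tpow_rels H n)"

definition tpow :: "('k::field, 'h::ring_1) hopf \<Rightarrow> nat \<Rightarrow> ('h list \<Rightarrow>\<^sub>0 'k) set set" where
  "tpow H n = {tpow_class H n p | p. Poly_Mapping.keys p \<subseteq> {a. length a = n}}"

definition tpow_mult :: "('k::field, 'h::ring_1) hopf \<Rightarrow> nat
    \<Rightarrow> ('h list \<Rightarrow>\<^sub>0 'k) set \<Rightarrow> ('h list \<Rightarrow>\<^sub>0 'k) set \<Rightarrow> ('h list \<Rightarrow>\<^sub>0 'k) set" where
  "tpow_mult H n A B = tpow_class H n
     (lin_ext (\<lambda>a. lin_ext (\<lambda>b. Poly_Mapping.single (map2 (*) a b) 1) (rep B)) (rep A))"

text \<open>\<open>id\<^sup>\<otimes>\<^sup>i \<otimes> \<Delta> \<otimes> id\<^sup>\<otimes>\<^sup>(\<^sup>n\<^sup>-\<^sup>i\<^sup>-\<^sup>1\<^sup>) : H\<^sup>\<otimes>\<^sup>n \<rightarrow> H\<^sup>\<otimes>\<^sup>(\<^sup>n\<^sup>+\<^sup>1\<^sup>)\<close>, with slots counted from \<open>0\<close>.\<close>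

definition comult_at :: "('k::field, 'h::ring_1) hopf \<Rightarrow> nat \<Rightarrow> nat
    \<Rightarrow> ('h list \<Rightarrow>\<^sub>0 'k) set \<Rightarrow> ('h list \<Rightarrow>\<^sub>0 'k) set" where
  "comult_at H n i A = tpow_class H (Suc n)
     (lin_ext (\<lambda>a. lin_ext (\<lambda>d. Poly_Mapping.single (take i a @ d @ drop (Suc i) a) 1)
                     (rep (comult H (a ! i)))) (rep A))"

text \<open>\<open>(F \<circ> \<Delta>)(h)\<close> for the linear map \<open>H \<otimes> H \<rightarrow> H\<close> induced by a bilinear \<open>F\<close>.\<close>

definition comult_eval :: "('k::field, 'h::ring_1) hopf \<Rightarrow> ('h \<Rightarrow> 'h \<Rightarrow> 'h) \<Rightarrow> 'h \<Rightarrow> 'h" where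
  "comult_eval H F h =
     (\<Sum>d\<in>Poly_Mapping.keys (rep (comult H h)).
        hscale H (Poly_Mapping.lookup (rep (comult H h)) d) (F (d ! 0) (d ! 1)))"

locale cocommutative_hopf_algebra =
  fixes H :: "('k::field, 'h::ring_1) hopf"
  assumes vector_space: "vector_space (hscale H)"
    and mult_scale_left: "hscale H c a * b = hscale H c (a * b)"
    and mult_scale_right: "a * hscale H c b = hscale H c (a * b)"
    and comult_closed: "comult H a \<in> tpow H 2"
    and comult_add: "comult H (a + b) = comult H a \<boxplus> comult H b"
    and comult_scale: "comult H (hscale H c a) = tpow_class H 2 (fscale c (rep (comult H a)))"
    and comult_mult: "comult H (a * b) = tpow_mult H 2 (comult H a) (comult H b)"
    and comult_one: "comult H 1 = tpow_class H 2 (Poly_Mapping.single [1, 1] 1)"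
    and counit_linear: "Vector_Spaces.linear (hscale H) (*) (counit H)"
    and counit_mult: "counit H (a * b) = counit H a * counit H b"
    and counit_one: "counit H 1 = 1"
    and coassoc: "comult_at H 2 0 (comult H a) = comult_at H 2 1 (comult H a)"
    and counit_left: "comult_eval H (\<lambda>u v. hscale H (counit H u) v) a = a"
    and counit_right: "comult_eval H (\<lambda>u v. hscale H (counit H v) u) a = a"
    and antipode_linear: "Vector_Spaces.linear (hscale H) (hscale H) (antipode H)"
    and antipode_left: "comult_eval H (\<lambda>u v. antipode H u * v) a = hscale H (counit H a) 1"
    and antipode_right: "comult_eval H (\<lambda>u v. u * antipode H v) a = hscale H (counit H a) 1"
    and cocommutative: "tpow_class H 2
          (lin_ext (\<lambda>d. Poly_Mapping.single (rev d) 1) (rep (comult H a))) = comult H a"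

text \<open>\<open>h\<^sub>(\<^sub>1\<^sub>) \<otimes> \<cdots> \<otimes> h\<^sub>(\<^sub>n\<^sub>)\<close>\<close>

fun iter_comult :: "('k::field, 'h::ring_1) hopf \<Rightarrow> nat \<Rightarrow> 'h \<Rightarrow> ('h list \<Rightarrow>\<^sub>0 'k) set" where
  "iter_comult H 0 h = tpow_class H 0 (Poly_Mapping.single [] (counit H h))"
| "iter_comult H (Suc 0) h = tpow_class H 1 (Poly_Mapping.single [h] 1)"
| "iter_comult H (Suc (Suc n)) h = comult_at H (Suc n) 0 (iter_comult H (Suc n) h)"


section \<open>Modules and polylinear maps\<close>

text \<open>HOL-Algebra's \<open>module\<close> locale needs a commutative base ring, so only its record is used here;
  the ring-multiplicative fields of that record play no role.\<close>

locale left_module =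
  fixes M :: "('h::ring_1, 'm) module" (structure)
  assumes abelian_group: "abelian_group M"
    and smult_closed: "x \<in> carrier M \<Longrightarrow> h \<odot> x \<in> carrier M"
    and smult_l_distr: "x \<in> carrier M \<Longrightarrow> (h + k) \<odot> x = h \<odot> x \<oplus> k \<odot> x"
    and smult_r_distr: "x \<in> carrier M \<Longrightarrow> y \<in> carrier M \<Longrightarrow> h \<odot> (x \<oplus> y) = h \<odot> x \<oplus> h \<odot> y"
    and smult_assoc: "x \<in> carrier M \<Longrightarrow> (h * k) \<odot> x = h \<odot> (k \<odot> x)"
    and smult_one: "x \<in> carrier M \<Longrightarrow> 1 \<odot> x = x"

definition H_linear :: "('h::ring_1, 'm) module \<Rightarrow> ('h, 'n) module \<Rightarrow> ('m \<Rightarrow> 'n) \<Rightarrow> bool" where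
  "H_linear M N f \<longleftrightarrow> f \<in> carrier M \<rightarrow> carrier N
     \<and> (\<forall>x\<in>carrier M. \<forall>y\<in>carrier M. f (x \<oplus>\<^bsub>M\<^esub> y) = f x \<oplus>\<^bsub>N\<^esub> f y)
     \<and> (\<forall>h. \<forall>x\<in>carrier M. f (h \<odot>\<^bsub>M\<^esub> x) = h \<odot>\<^bsub>N\<^esub> f x)"

text \<open>\<open>H\<^sup>\<otimes>\<^sup>n \<otimes>\<^sub>H M\<close>: the pair \<open>(a, x)\<close> stands for \<open>(a\<^sub>1 \<otimes> \<cdots> \<otimes> a\<^sub>n) \<otimes>\<^sub>H x\<close>.  The relations are those
  of \<open>H\<^sup>\<otimes>\<^sup>n\<close>, additivity in \<open>x\<close>, and
  \<open>(a\<^sub>1 \<otimes> \<cdots> \<otimes> a\<^sub>n) \<otimes>\<^sub>H h x = (a\<^sub>1 h\<^sub>(\<^sub>1\<^sub>) \<otimes> \<cdots> \<otimes> a\<^sub>n h\<^sub>(\<^sub>n\<^sub>)) \<otimes>\<^sub>H x\<close>.\<close>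

definition tens_rels :: "('k::field, 'h::ring_1) hopf \<Rightarrow> nat \<Rightarrow> ('h, 'm) module
    \<Rightarrow> ('h list \<times> 'm \<Rightarrow>\<^sub>0 'k) set" where
  "tens_rels H n M =
     {lin_ext (\<lambda>a. Poly_Mapping.single (a, x) 1) r | r x. r \<in> tpow_rels H n \<and> x \<in> carrier M}
   \<union> {Poly_Mapping.single (a, x \<oplus>\<^bsub>M\<^esub> y) 1 - Poly_Mapping.single (a, x) 1 - Poly_Mapping.single (a, y) 1
        | a x y. length a = n \<and> x \<in> carrier M \<and> y \<in> carrier M}
   \<union> {Poly_Mapping.single (a, h \<odot>\<^bsub>M\<^esub> x) 1
        - lin_ext (\<lambda>d. Poly_Mapping.single (map2 (*) a d, x) 1) (rep (iter_comult H n h))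
        | a h x. length a = n \<and> x \<in> carrier M}"

abbreviation tens_class :: "('k::field, 'h::ring_1) hopf \<Rightarrow> nat \<Rightarrow> ('h, 'm) module
    \<Rightarrow> ('h list \<times> 'm \<Rightarrow>\<^sub>0 'k) \<Rightarrow> ('h list \<times> 'm \<Rightarrow>\<^sub>0 'k) set" where
  "tens_class H n M \<equiv> coset (tens_rels H n M)"

definition tens :: "('k::field, 'h::ring_1) hopf \<Rightarrow> nat \<Rightarrow> ('h, 'm) module
    \<Rightarrow> ('h list \<times> 'm \<Rightarrow>\<^sub>0 'k) set set" where
  "tens H n M = {tens_class H n M p | p. Poly_Mapping.keys p \<subseteq> {a. length a = n} \<times> carrier M}"

text \<open>Left multiplication by \<open>c\<^sub>1 \<otimes> \<cdots> \<otimes> c\<^sub>n\<close>.\<close>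

definition tens_lmult :: "('k::field, 'h::ring_1) hopf \<Rightarrow> nat \<Rightarrow> ('h, 'm) module \<Rightarrow> 'h list
    \<Rightarrow> ('h list \<times> 'm \<Rightarrow>\<^sub>0 'k) set \<Rightarrow> ('h list \<times> 'm \<Rightarrow>\<^sub>0 'k) set" where
  "tens_lmult H n M c A = tens_class H n M
     (lin_ext (\<lambda>(a, x). Poly_Mapping.single (map2 (*) c a, x) 1) (rep A))"

text \<open>\<open>id \<otimes>\<^sub>H g : H\<^sup>\<otimes>\<^sup>n \<otimes>\<^sub>H M \<rightarrow> H\<^sup>\<otimes>\<^sup>n \<otimes>\<^sub>H N\<close>.\<close>

definition tens_map :: "('k::field, 'h::ring_1) hopf \<Rightarrow> nat \<Rightarrow> ('h, 'n) module \<Rightarrow> ('m \<Rightarrow> 'n)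
    \<Rightarrow> ('h list \<times> 'm \<Rightarrow>\<^sub>0 'k) set \<Rightarrow> ('h list \<times> 'n \<Rightarrow>\<^sub>0 'k) set" where
  "tens_map H n N g A = tens_class H n N
     (lin_ext (\<lambda>(a, x). Poly_Mapping.single (a, g x) 1) (rep A))"

text \<open>The slot convention: if the \<open>i\<close>-th factor of \<open>A\<close> is attached to the argument number
  \<open>ps ! i\<close>, then the factors of \<open>arrange H M ps A\<close> appear in the order of the argument numbers.
  For instance, an expression with arguments in the order \<open>y, x, z\<close> is brought to the order
  \<open>x, y, z\<close> by \<open>ps = [1, 0, 2]\<close>.\<close>

definition arrange :: "('k::field, 'h::ring_1) hopf \<Rightarrow> ('h, 'm) module \<Rightarrow> nat list
    \<Rightarrow> ('h list \<times> 'm \<Rightarrow>\<^sub>0 'k) set \<Rightarrow> ('h list \<times> 'm \<Rightarrow>\<^sub>0 'k) set" where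
  "arrange H M ps A = tens_class H (length ps) M
     (lin_ext (\<lambda>(a, x). Poly_Mapping.single (map snd (sort_key fst (zip ps a)), x) 1) (rep A))"

text \<open>An \<open>H\<^sup>\<otimes>\<^sup>n\<close>-linear map on \<open>M\<^sub>1 \<otimes> \<cdots> \<otimes> M\<^sub>n\<close> is given as a multiadditive function; linearity over
  the base field is equivariance under the multiples of \<open>1\<close>.\<close>

definition polylinear2 :: "('k::field, 'h::ring_1) hopf \<Rightarrow> ('h, 'm1) module \<Rightarrow> ('h, 'm2) module
    \<Rightarrow> ('h, 'n) module \<Rightarrow> ('m1 \<Rightarrow> 'm2 \<Rightarrow> ('h list \<times> 'n \<Rightarrow>\<^sub>0 'k) set) \<Rightarrow> bool" where
  "polylinear2 H M1 M2 N \<phi> \<longleftrightarrow>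
     (\<forall>x\<in>carrier M1. \<forall>y\<in>carrier M2. \<phi> x y \<in> tens H 2 N)
   \<and> (\<forall>x\<in>carrier M1. \<forall>x'\<in>carrier M1. \<forall>y\<in>carrier M2. \<phi> (x \<oplus>\<^bsub>M1\<^esub> x') y = \<phi> x y \<boxplus> \<phi> x' y)
   \<and> (\<forall>x\<in>carrier M1. \<forall>y\<in>carrier M2. \<forall>y'\<in>carrier M2. \<phi> x (y \<oplus>\<^bsub>M2\<^esub> y') = \<phi> x y \<boxplus> \<phi> x y')
   \<and> (\<forall>x\<in>carrier M1. \<forall>y\<in>carrier M2. \<forall>h k.
        \<phi> (h \<odot>\<^bsub>M1\<^esub> x) (k \<odot>\<^bsub>M2\<^esub> y) = tens_lmult H 2 N [h, k] (\<phi> x y))"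

definition polylinear3 :: "('k::field, 'h::ring_1) hopf \<Rightarrow> ('h, 'm1) module \<Rightarrow> ('h, 'm2) module
    \<Rightarrow> ('h, 'm3) module \<Rightarrow> ('h, 'n) module
    \<Rightarrow> ('m1 \<Rightarrow> 'm2 \<Rightarrow> 'm3 \<Rightarrow> ('h list \<times> 'n \<Rightarrow>\<^sub>0 'k) set) \<Rightarrow> bool" where
  "polylinear3 H M1 M2 M3 N \<phi> \<longleftrightarrow>
     (\<forall>x\<in>carrier M1. \<forall>y\<in>carrier M2. \<forall>z\<in>carrier M3. \<phi> x y z \<in> tens H 3 N)
   \<and> (\<forall>x\<in>carrier M1. \<forall>x'\<in>carrier M1. \<forall>y\<in>carrier M2. \<forall>z\<in>carrier M3.
        \<phi> (x \<oplus>\<^bsub>M1\<^esub> x') y z = \<phi> x y z \<boxplus> \<phi> x' y z)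
   \<and> (\<forall>x\<in>carrier M1. \<forall>y\<in>carrier M2. \<forall>y'\<in>carrier M2. \<forall>z\<in>carrier M3.
        \<phi> x (y \<oplus>\<^bsub>M2\<^esub> y') z = \<phi> x y z \<boxplus> \<phi> x y' z)
   \<and> (\<forall>x\<in>carrier M1. \<forall>y\<in>carrier M2. \<forall>z\<in>carrier M3. \<forall>z'\<in>carrier M3.
        \<phi> x y (z \<oplus>\<^bsub>M3\<^esub> z') = \<phi> x y z \<boxplus> \<phi> x y z')
   \<and> (\<forall>x\<in>carrier M1. \<forall>y\<in>carrier M2. \<forall>z\<in>carrier M3. \<forall>h k l.
        \<phi> (h \<odot>\<^bsub>M1\<^esub> x) (k \<odot>\<^bsub>M2\<^esub> y) (l \<odot>\<^bsub>M3\<^esub> z) = tens_lmult H 3 N [h, k, l] (\<phi> x y z))"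

definition skew2 :: "('k::field, 'h::ring_1) hopf \<Rightarrow> ('h, 'm) module \<Rightarrow> ('h, 'n) module
    \<Rightarrow> ('m \<Rightarrow> 'm \<Rightarrow> ('h list \<times> 'n \<Rightarrow>\<^sub>0 'k) set) \<Rightarrow> bool" where
  "skew2 H M N \<phi> \<longleftrightarrow>
     (\<forall>x\<in>carrier M. \<forall>y\<in>carrier M. arrange H N [1, 0] (\<phi> y x) = cneg (\<phi> x y))"

definition skew3 :: "('k::field, 'h::ring_1) hopf \<Rightarrow> ('h, 'm) module \<Rightarrow> ('h, 'n) module
    \<Rightarrow> ('m \<Rightarrow> 'm \<Rightarrow> 'm \<Rightarrow> ('h list \<times> 'n \<Rightarrow>\<^sub>0 'k) set) \<Rightarrow> bool" where
  "skew3 H M N \<phi> \<longleftrightarrow> (\<forall>x\<in>carrier M. \<forall>y\<in>carrier M. \<forall>z\<in>carrier M.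
       arrange H N [1, 0, 2] (\<phi> y x z) = cneg (\<phi> x y z)
     \<and> arrange H N [0, 2, 1] (\<phi> x z y) = cneg (\<phi> x y z)
     \<and> arrange H N [2, 1, 0] (\<phi> z y x) = cneg (\<phi> x y z))"

text \<open>Composition of polylinear maps.  \<open>A = \<psi>(y\<^sub>1, \<dots>, y\<^sub>l)\<close> is substituted into slot \<open>m\<close> (counted
  from \<open>0\<close>) of a \<open>k\<close>-ary polylinear map whose other arguments are fixed, which leaves a function
  \<open>G\<close>.  If \<open>A = \<Sum> h \<otimes>\<^sub>H e\<close> and \<open>G e = \<Sum> f \<otimes>\<^sub>H e'\<close>, the result is
  \<open>\<Sum> (f\<^sub>0 \<otimes> \<cdots> \<otimes> f\<^sub>m\<^sub>-\<^sub>1 \<otimes> h\<^sub>1 f\<^sub>m\<^sub>(\<^sub>1\<^sub>) \<otimes> \<cdots> \<otimes> h\<^sub>l f\<^sub>m\<^sub>(\<^sub>l\<^sub>) \<otimes> f\<^sub>m\<^sub>+\<^sub>1 \<otimes> \<cdots>) \<otimes>\<^sub>H e'\<close>.\<close>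

definition plug :: "('k::field, 'h::ring_1) hopf \<Rightarrow> ('h, 'n) module \<Rightarrow> nat \<Rightarrow> nat \<Rightarrow> nat
    \<Rightarrow> ('m \<Rightarrow> ('h list \<times> 'n \<Rightarrow>\<^sub>0 'k) set) \<Rightarrow> ('h list \<times> 'm \<Rightarrow>\<^sub>0 'k) set
    \<Rightarrow> ('h list \<times> 'n \<Rightarrow>\<^sub>0 'k) set" where
  "plug H N k m l G A = tens_class H (k + l - 1) N
     (lin_ext (\<lambda>(h, e).
        lin_ext (\<lambda>(f, e').
          lin_ext (\<lambda>d. Poly_Mapping.single (take m f @ map2 (*) h d @ drop (Suc m) f, e') 1)
            (rep (iter_comult H l (f ! m))))
          (rep (G e)))
        (rep A))"


section \<open>2-term \<open>L\<^sub>\<infinity>\<close> pseudoalgebras\<close>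

text \<open>\<open>beta2_ij\<close> is the component of \<open>\<beta>\<^sub>2\<close> on \<open>L\<^sub>i \<boxtimes> L\<^sub>j\<close>; the one on \<open>L\<^sub>1 \<boxtimes> L\<^sub>1\<close> is zero and omitted.\<close>

record (overloaded) ('k::zero, 'h, 'a, 'b) two_term =
  L0 :: "('h, 'a) module"
  L1 :: "('h, 'b) module"
  beta1 :: "'b \<Rightarrow> 'a"
  beta2_00 :: "'a \<Rightarrow> 'a \<Rightarrow> ('h list \<times> 'a \<Rightarrow>\<^sub>0 'k) set"
  beta2_01 :: "'a \<Rightarrow> 'b \<Rightarrow> ('h list \<times> 'b \<Rightarrow>\<^sub>0 'k) set"
  beta2_10 :: "'b \<Rightarrow> 'a \<Rightarrow> ('h list \<times> 'b \<Rightarrow>\<^sub>0 'k) set"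
  beta3 :: "'a \<Rightarrow> 'a \<Rightarrow> 'a \<Rightarrow> ('h list \<times> 'b \<Rightarrow>\<^sub>0 'k) set"

locale two_term_Linf_pseudoalgebra =
  fixes H :: "('k::field, 'h::ring_1) hopf" and L :: "('k, 'h, 'a, 'b) two_term"
  assumes module0: "left_module (L0 L)"
    and module1: "left_module (L1 L)"
    and beta1_linear: "H_linear (L1 L) (L0 L) (beta1 L)"
    and beta2_00_polylinear: "polylinear2 H (L0 L) (L0 L) (L0 L) (beta2_00 L)"
    and beta2_01_polylinear: "polylinear2 H (L0 L) (L1 L) (L1 L) (beta2_01 L)"
    and beta2_10_polylinear: "polylinear2 H (L1 L) (L0 L) (L1 L) (beta2_10 L)"
    and beta2_skew: "skew2 H (L0 L) (L0 L) (beta2_00 L)"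
    and beta2_skew_mixed: "\<lbrakk>x \<in> carrier (L0 L); u \<in> carrier (L1 L)\<rbrakk> \<Longrightarrow>
          arrange H (L1 L) [1, 0] (beta2_10 L u x) = cneg (beta2_01 L x u)"
    and beta3_polylinear: "polylinear3 H (L0 L) (L0 L) (L0 L) (L1 L) (beta3 L)"
    and beta3_skew: "skew3 H (L0 L) (L1 L) (beta3 L)"
    and eq_i: "\<lbrakk>x \<in> carrier (L0 L); u \<in> carrier (L1 L)\<rbrakk> \<Longrightarrow>
          tens_map H 2 (L0 L) (beta1 L) (beta2_01 L x u) = beta2_00 L x (beta1 L u)"
    and eq_ii: "\<lbrakk>u \<in> carrier (L1 L); v \<in> carrier (L1 L)\<rbrakk> \<Longrightarrow>
          beta2_01 L (beta1 L u) v = beta2_10 L u (beta1 L v)"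
    and eq_iii: "\<lbrakk>x \<in> carrier (L0 L); y \<in> carrier (L0 L); z \<in> carrier (L0 L)\<rbrakk> \<Longrightarrow>
          plug H (L0 L) 2 0 2 (\<lambda>e. beta2_00 L e z) (beta2_00 L x y)
          \<boxminus> plug H (L0 L) 2 1 2 (\<lambda>e. beta2_00 L x e) (beta2_00 L y z)
          \<boxplus> arrange H (L0 L) [1, 0, 2] (plug H (L0 L) 2 1 2 (\<lambda>e. beta2_00 L y e) (beta2_00 L x z))
          = cneg (tens_map H 3 (L0 L) (beta1 L) (beta3 L x y z))"
    and eq_iv: "\<lbrakk>x \<in> carrier (L0 L); y \<in> carrier (L0 L); v \<in> carrier (L1 L)\<rbrakk> \<Longrightarrow>
          plug H (L1 L) 2 0 2 (\<lambda>e. beta2_01 L e v) (beta2_00 L x y)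
          \<boxminus> plug H (L1 L) 2 1 2 (\<lambda>e. beta2_01 L x e) (beta2_01 L y v)
          \<boxplus> arrange H (L1 L) [1, 0, 2] (plug H (L1 L) 2 1 2 (\<lambda>e. beta2_01 L y e) (beta2_01 L x v))
          = cneg (beta3 L x y (beta1 L v))"
    and eq_v: "\<lbrakk>x \<in> carrier (L0 L); y \<in> carrier (L0 L); z \<in> carrier (L0 L); w \<in> carrier (L0 L)\<rbrakk> \<Longrightarrow>
          plug H (L1 L) 2 1 3 (\<lambda>e. beta2_01 L x e) (beta3 L y z w)
          \<boxminus> arrange H (L1 L) [1, 0, 2, 3] (plug H (L1 L) 2 1 3 (\<lambda>e. beta2_01 L y e) (beta3 L x z w))
          \<boxplus> arrange H (L1 L) [2, 0, 1, 3] (plug H (L1 L) 2 1 3 (\<lambda>e. beta2_01 L z e) (beta3 L x y w))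
          \<boxminus> arrange H (L1 L) [3, 0, 1, 2] (plug H (L1 L) 2 1 3 (\<lambda>e. beta2_01 L w e) (beta3 L x y z))
          \<boxminus> plug H (L1 L) 3 0 2 (\<lambda>e. beta3 L e z w) (beta2_00 L x y)
          \<boxplus> arrange H (L1 L) [0, 2, 1, 3] (plug H (L1 L) 3 0 2 (\<lambda>e. beta3 L e y w) (beta2_00 L x z))
          \<boxminus> arrange H (L1 L) [0, 3, 1, 2] (plug H (L1 L) 3 0 2 (\<lambda>e. beta3 L e y z) (beta2_00 L x w))
          \<boxminus> arrange H (L1 L) [1, 2, 0, 3] (plug H (L1 L) 3 0 2 (\<lambda>e. beta3 L e x w) (beta2_00 L y z))
          \<boxplus> arrange H (L1 L) [1, 3, 0, 2] (plug H (L1 L) 3 0 2 (\<lambda>e. beta3 L e x z) (beta2_00 L y w))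
          \<boxminus> arrange H (L1 L) [2, 3, 0, 1] (plug H (L1 L) 3 0 2 (\<lambda>e. beta3 L e x y) (beta2_00 L z w))
          = tens_class H 4 (L1 L) 0"


section \<open>Morphisms and their composition\<close>

record (overloaded) ('k::zero, 'h, 'a, 'b) mor =
  mor0 :: "'a \<Rightarrow> 'a"
  mor1 :: "'b \<Rightarrow> 'b"
  mor2 :: "'a \<Rightarrow> 'a \<Rightarrow> ('h list \<times> 'b \<Rightarrow>\<^sub>0 'k) set"

text \<open>The components of a morphism are extensional (undefined outside the carriers), so that equality
  of morphisms is equality of the maps on the modules.  As for \<open>\<beta>\<^sub>2\<close> and \<open>\<beta>\<^sub>3\<close>, the polylinear
  component \<open>f\<^sub>2\<close> is skew-symmetric; without this, morphisms would not be closed under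
  composition.\<close>

locale two_term_morphism =
  fixes H :: "('k::field, 'h::ring_1) hopf"
    and X Y :: "('k, 'h, 'a, 'b) two_term"
    and f :: "('k, 'h, 'a, 'b) mor"
  assumes mor0_linear: "H_linear (L0 X) (L0 Y) (mor0 f)"
    and mor0_ext: "mor0 f \<in> extensional (carrier (L0 X))"
    and mor1_linear: "H_linear (L1 X) (L1 Y) (mor1 f)"
    and mor1_ext: "mor1 f \<in> extensional (carrier (L1 X))"
    and mor2_polylinear: "polylinear2 H (L0 X) (L0 X) (L1 Y) (mor2 f)"
    and mor2_skew: "skew2 H (L0 X) (L1 Y) (mor2 f)"
    and mor2_ext: "mor2 f \<in> extensional (carrier (L0 X))"
      "\<And>x. x \<in> carrier (L0 X) \<Longrightarrow> mor2 f x \<in> extensional (carrier (L0 X))"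
    and mor_beta1: "u \<in> carrier (L1 X) \<Longrightarrow> beta1 Y (mor1 f u) = mor0 f (beta1 X u)"
    and mor_beta2_00: "\<lbrakk>x \<in> carrier (L0 X); y \<in> carrier (L0 X)\<rbrakk> \<Longrightarrow>
          tens_map H 2 (L0 Y) (mor0 f) (beta2_00 X x y) \<boxminus> beta2_00 Y (mor0 f x) (mor0 f y)
          = tens_map H 2 (L0 Y) (beta1 Y) (mor2 f x y)"
    and mor_beta2_01: "\<lbrakk>x \<in> carrier (L0 X); u \<in> carrier (L1 X)\<rbrakk> \<Longrightarrow>
          tens_map H 2 (L1 Y) (mor1 f) (beta2_01 X x u) \<boxminus> beta2_01 Y (mor0 f x) (mor1 f u)
          = mor2 f x (beta1 X u)"
    and mor_beta3: "\<lbrakk>x \<in> carrier (L0 X); y \<in> carrier (L0 X); z \<in> carrier (L0 X)\<rbrakk> \<Longrightarrow>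
          plug H (L1 Y) 2 0 2 (\<lambda>e. beta2_10 Y e (mor0 f z)) (mor2 f x y)
          \<boxminus> plug H (L1 Y) 2 1 2 (\<lambda>e. beta2_01 Y (mor0 f x) e) (mor2 f y z)
          \<boxplus> arrange H (L1 Y) [1, 0, 2] (plug H (L1 Y) 2 1 2 (\<lambda>e. beta2_01 Y (mor0 f y) e) (mor2 f x z))
          \<boxplus> plug H (L1 Y) 2 0 2 (\<lambda>e. mor2 f e z) (beta2_00 X x y)
          \<boxminus> plug H (L1 Y) 2 1 2 (\<lambda>e. mor2 f x e) (beta2_00 X y z)
          \<boxplus> arrange H (L1 Y) [1, 0, 2] (plug H (L1 Y) 2 1 2 (\<lambda>e. mor2 f y e) (beta2_00 X x z))
          = beta3 Y (mor0 f x) (mor0 f y) (mor0 f z) \<boxminus> tens_map H 3 (L1 Y) (mor1 f) (beta3 X x y z)"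

definition mor_comp :: "('k::field, 'h::ring_1) hopf
    \<Rightarrow> ('k, 'h, 'a, 'b) two_term \<Rightarrow> ('k, 'h, 'a, 'b) two_term \<Rightarrow> ('k, 'h, 'a, 'b) two_term
    \<Rightarrow> ('k, 'h, 'a, 'b) mor \<Rightarrow> ('k, 'h, 'a, 'b) mor \<Rightarrow> ('k, 'h, 'a, 'b) mor" where
  "mor_comp H X Y Z g f =
     \<lparr> mor0 = compose (carrier (L0 X)) (mor0 g) (mor0 f),
       mor1 = compose (carrier (L1 X)) (mor1 g) (mor1 f),
       mor2 = (\<lambda>x\<in>carrier (L0 X). \<lambda>y\<in>carrier (L0 X).
         mor2 g (mor0 f x) (mor0 f y) \<boxplus> tens_map H 2 (L1 Z) (mor1 g) (mor2 f x y)) \<rparr>"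

text \<open>The collection is relative to a universe: the modules have their carriers inside the types \<open>'a\<close>
  and \<open>'b\<close>, which are arbitrary.\<close>

definition pseudoalgebras :: "('k::field, 'h::ring_1) hopf \<Rightarrow> ('k, 'h, 'a, 'b) two_term set" where
  "pseudoalgebras H = {L. two_term_Linf_pseudoalgebra H L}"

definition pseudoalgebra_hom :: "('k::field, 'h::ring_1) hopf
    \<Rightarrow> ('k, 'h, 'a, 'b) two_term \<Rightarrow> ('k, 'h, 'a, 'b) two_term \<Rightarrow> ('k, 'h, 'a, 'b) mor set" where
  "pseudoalgebra_hom H X Y = {f. two_term_morphism H X Y f}"


section \<open>Categories\<close>

text \<open>\<open>Comp X Y Z g f\<close> is the composite of \<open>f : X \<rightarrow> Y\<close> and \<open>g : Y \<rightarrow> Z\<close>.\<close>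

locale category =
  fixes Obj :: "'o set"
    and Hom :: "'o \<Rightarrow> 'o \<Rightarrow> 'm set"
    and Comp :: "'o \<Rightarrow> 'o \<Rightarrow> 'o \<Rightarrow> 'm \<Rightarrow> 'm \<Rightarrow> 'm"
  assumes comp_closed: "\<lbrakk>X \<in> Obj; Y \<in> Obj; Z \<in> Obj; f \<in> Hom X Y; g \<in> Hom Y Z\<rbrakk>
        \<Longrightarrow> Comp X Y Z g f \<in> Hom X Z"
    and comp_assoc: "\<lbrakk>X \<in> Obj; Y \<in> Obj; Z \<in> Obj; W \<in> Obj; f \<in> Hom X Y; g \<in> Hom Y Z; h \<in> Hom Z W\<rbrakk>
        \<Longrightarrow> Comp X Z W h (Comp X Y Z g f) = Comp X Y W (Comp Y Z W h g) f"
    and identities: "X \<in> Obj \<Longrightarrow> \<exists>i\<in>Hom X X.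
          (\<forall>Y\<in>Obj. \<forall>f\<in>Hom X Y. Comp X X Y f i = f) \<and> (\<forall>Y\<in>Obj. \<forall>f\<in>Hom Y X. Comp Y X X i f = f)"

end

theory Submission
  imports Defs
begin

text \<open>Every operation on \<open>H\<^sup>\<otimes>\<^sup>n \<otimes>\<^sub>H M\<close> is induced by a linear map between free vector spaces that
  preserves the relations, so it does not depend on the chosen representatives and identities can
  be checked on generators.  For the substitution of one polylinear map into another this uses that
  \<open>\<Delta>\<close> is multiplicative (balancing of the inserted element) and coassociative (balancing of
  the result); for the slot convention it uses cocommutativity.  In the last morphism identity for a
  composite \<open>g \<circ> f\<close>, the identities of \<open>g\<close> at degree \<open>(1,0)\<close> and \<open>(0,1)\<close> replace
  \<open>\<beta>\<^sub>2''(g\<^sub>1 f\<^sub>2(x,y), g\<^sub>0 f\<^sub>0 z)\<close> by \<open>g\<^sub>1 \<beta>\<^sub>2'(f\<^sub>2(x,y), f\<^sub>0 z) - g\<^sub>2(\<beta>\<^sub>1' f\<^sub>2(x,y), f\<^sub>0 z)\<close>, and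
  \<open>\<beta>\<^sub>1' f\<^sub>2(x,y) = f\<^sub>0 \<beta>\<^sub>2(x,y) - \<beta>\<^sub>2'(f\<^sub>0 x, f\<^sub>0 y)\<close>; what remains is the identity for \<open>g\<close> at
  \<open>f\<^sub>0 x, f\<^sub>0 y, f\<^sub>0 z\<close> plus \<open>g\<^sub>1\<close> applied to the identity for \<open>f\<close>.\<close>

text \<open>Two obstacles shape the development. The first is that \<open>rep\<close> picks an
  arbitrary element of a coset. Before generators can be inspected, it must be known that this
  element involves only lists of the right length and module elements in the carrier; this is the
  role of \<open>finsupp\<close> and of the membership conditions \<open>\<in> tens H n M\<close>
  throughout. The second is that a morphism only postulates the identity in degree (0,1). The one in
  degree (1,0) is derived by exchanging the arguments, and this is where skew-symmetry of
  \<open>f\<^sub>2\<close> enters. The six terms on the left of the last morphism identity are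
  grouped into three pairs. Each consists of a \<open>\<beta>\<^sub>2\<close>-term and an
  \<open>f\<^sub>2\<close>-term that substitute into the same slot with the same arguments. Neither
  member of a pair behaves well under composition, but their sum does, so all cancellation takes
  place inside a pair. The third pair is the second with \<open>x\<close> and \<open>y\<close>
  exchanged. Hence only substitutions of a binary map into a binary map occur, and the only
  permutation of factors is the exchange of the first two.\<close>

section \<open>Congruences in free vector spaces\<close>

abbreviation gen :: "'x \<Rightarrow> ('x \<Rightarrow>\<^sub>0 'k::field)" where
  "gen x \<equiv> Poly_Mapping.single x 1"

lemma lookup_fscale: "Poly_Mapping.lookup (fscale c p) x = c * Poly_Mapping.lookup p x"
  by (simp add: fscale_def Poly_Mapping.map.rep_eq when_def)

interpretation free: vector_space "fscale :: 'k::field \<Rightarrow> ('x \<Rightarrow>\<^sub>0 'k) \<Rightarrow> ('x \<Rightarrow>\<^sub>0 'k)"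
  by unfold_locales (auto intro!: poly_mapping_eqI simp: lookup_fscale lookup_add algebra_simps)

lemma fscale_single: "fscale c (Poly_Mapping.single x d) = Poly_Mapping.single x (c * d)"
  by (auto intro!: poly_mapping_eqI simp: lookup_fscale lookup_single when_def)

text \<open>The defining sum runs over the support, which changes with the argument; a common finite
  index set turns linearity into a termwise statement.\<close>

lemma lin_ext_superset:
  assumes "finite A" "Poly_Mapping.keys p \<subseteq> A"
  shows "lin_ext F p = (\<Sum>x\<in>A. fscale (Poly_Mapping.lookup p x) (F x))"
  unfolding lin_ext_def using assms
  by (intro sum.mono_neutral_left) (auto simp: in_keys_iff)

lemma lin_ext_0 [simp]: "lin_ext F 0 = 0"
  by (simp add: lin_ext_def)

lemma lin_ext_add: "lin_ext F (p + q) = lin_ext F p + lin_ext F q"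
proof -
  let ?A = "Poly_Mapping.keys p \<union> Poly_Mapping.keys q"
  have A: "finite ?A" by simp
  have k: "Poly_Mapping.keys (p + q) \<subseteq> ?A" by (rule Poly_Mapping.keys_add)
  show ?thesis
    using lin_ext_superset[OF A k, of F] lin_ext_superset[OF A, of p F] lin_ext_superset[OF A, of q F]
    by (simp add: lookup_add free.scale_left_distrib sum.distrib)
qed

lemma lin_ext_fscale: "lin_ext F (fscale c p) = fscale c (lin_ext F p)"
proof -
  have "Poly_Mapping.keys (fscale c p) \<subseteq> Poly_Mapping.keys p"
    by (auto simp: in_keys_iff lookup_fscale)
  then have "lin_ext F (fscale c p)
      = (\<Sum>x\<in>Poly_Mapping.keys p. fscale (Poly_Mapping.lookup (fscale c p) x) (F x))"
    by (intro lin_ext_superset) auto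
  also have "\<dots> = fscale c (lin_ext F p)"
    by (simp add: lin_ext_def lookup_fscale free.scale_sum_right)
  finally show ?thesis .
qed

lemma lin_ext_uminus: "lin_ext F (- p) = - lin_ext F p"
  using lin_ext_fscale[of F "-1" p] by simp

lemma lin_ext_diff: "lin_ext F (p - q) = lin_ext F p - lin_ext F q"
  using lin_ext_add[of F p "- q"] by (simp add: lin_ext_uminus)

lemma lin_ext_sum: "lin_ext F (\<Sum>x\<in>A. g x) = (\<Sum>x\<in>A. lin_ext F (g x))"
  by (induction A rule: infinite_finite_induct) (auto simp: lin_ext_add)

lemma lin_ext_single [simp]: "lin_ext F (Poly_Mapping.single x c) = fscale c (F x)"
  by (cases "c = 0") (auto simp: lin_ext_def)

lemma lin_ext_lin_ext: "lin_ext G (lin_ext F p) = lin_ext (\<lambda>x. lin_ext G (F x)) p"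
  by (simp add: lin_ext_def[of F] lin_ext_def[of "\<lambda>x. lin_ext G (F x)"] lin_ext_sum lin_ext_fscale)

lemma lin_ext_swap:
  "lin_ext (\<lambda>x. lin_ext (\<lambda>y. F x y) q) p = lin_ext (\<lambda>y. lin_ext (\<lambda>x. F x y) p) q"
  by (simp add: lin_ext_def free.scale_sum_right sum.swap[of _ "Poly_Mapping.keys q"] mult.commute)

lemma lin_ext_cong:
  "(\<And>x. x \<in> Poly_Mapping.keys p \<Longrightarrow> F x = G x) \<Longrightarrow> lin_ext F p = lin_ext G p"
  by (simp add: lin_ext_def)

lemma lin_ext_gen [simp]: "lin_ext gen p = p"
  by (intro poly_mapping_eqI)
    (simp add: lin_ext_def fscale_single lookup_sum lookup_single when_def sum.delta in_keys_iff)

lemma lin_ext_zero_fun [simp]: "lin_ext (\<lambda>x. 0) p = 0"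
  by (simp add: lin_ext_def)

lemma lin_ext_add_fun: "lin_ext (\<lambda>x. F x + G x) p = lin_ext F p + lin_ext G p"
  by (simp add: lin_ext_def free.scale_right_distrib sum.distrib)

lemma lin_ext_diff_fun: "lin_ext (\<lambda>x. F x - G x) p = lin_ext F p - lin_ext G p"
  by (simp add: lin_ext_def free.scale_right_diff_distrib sum_subtractf)

lemma lin_ext_fscale_fun: "lin_ext (\<lambda>x. fscale c (F x)) p = fscale c (lin_ext F p)"
  by (simp add: lin_ext_def free.scale_sum_right mult.commute)

text \<open>Equality in the quotient, expressed on representatives. Being transitive and additive,
  it permits calculational chains in the free space without passing to cosets.\<close>

definition eq_mod :: "('x \<Rightarrow>\<^sub>0 'k::field) set \<Rightarrow> ('x \<Rightarrow>\<^sub>0 'k) \<Rightarrow> ('x \<Rightarrow>\<^sub>0 'k) \<Rightarrow> bool" where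
  "eq_mod R p q \<longleftrightarrow> p - q \<in> free.span R"

lemma eq_mod_refl [simp]: "eq_mod R p p"
  by (simp add: eq_mod_def free.span_zero)

lemma eq_mod_sym: "eq_mod R p q \<Longrightarrow> eq_mod R q p"
  unfolding eq_mod_def using free.span_neg[of "p - q" R] by simp

lemma eq_mod_trans [trans]: "eq_mod R p q \<Longrightarrow> eq_mod R q r \<Longrightarrow> eq_mod R p r"
  unfolding eq_mod_def using free.span_add[of "p - q" R "q - r"] by simp

lemma eq_mod_add: "eq_mod R p q \<Longrightarrow> eq_mod R p' q' \<Longrightarrow> eq_mod R (p + p') (q + q')"
  unfolding eq_mod_def using free.span_add[of "p - q" R "p' - q'"] by (simp add: algebra_simps)

lemma eq_mod_base: "p - q \<in> R \<Longrightarrow> eq_mod R p q"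
  by (simp add: eq_mod_def free.span_base)

lemma mem_coset: "q \<in> coset R p \<longleftrightarrow> eq_mod R p q"
  by (simp add: coset_def eq_mod_def)

lemma coset_eq_iff: "coset R p = coset R q \<longleftrightarrow> eq_mod R p q"
proof
  assume "coset R p = coset R q"
  moreover have "q \<in> coset R q" by (simp add: mem_coset)
  ultimately show "eq_mod R p q" by (simp only: mem_coset[symmetric])
next
  assume pq: "eq_mod R p q"
  have "eq_mod R p z \<longleftrightarrow> eq_mod R q z" for z
    using eq_mod_trans[OF pq] eq_mod_trans[OF eq_mod_sym[OF pq]] by blast
  then show "coset R p = coset R q"
    by (simp add: set_eq_iff mem_coset)
qed

lemma eq_mod_rep_coset: "eq_mod R p (rep (coset R p))"
proof -
  have "p \<in> coset R p" by (simp add: coset_def free.span_zero)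
  then have "rep (coset R p) \<in> coset R p" unfolding rep_def by (rule someI)
  then show ?thesis by (simp add: coset_def eq_mod_def)
qed

lemma coset_rep_coset [simp]: "coset R (rep (coset R p)) = coset R p"
  by (rule sym) (simp only: coset_eq_iff eq_mod_rep_coset)

lemma coset_add: "coset R p \<boxplus> coset R q = coset R (p + q)"
proof (intro equalityI subsetI)
  fix z assume "z \<in> coset R p \<boxplus> coset R q"
  then show "z \<in> coset R (p + q)"
    by (auto simp: cplus_def coset_def eq_mod_def[symmetric] intro: eq_mod_add)
next
  fix z assume "z \<in> coset R (p + q)"
  then have "z - q \<in> coset R p" "q \<in> coset R q" "z = (z - q) + q"
    by (auto simp: coset_def free.span_zero algebra_simps)
  then show "z \<in> coset R p \<boxplus> coset R q" unfolding cplus_def by blast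
qed

lemma coset_neg: "cneg (coset R p) = coset R (- p)"
proof (intro equalityI subsetI)
  fix z assume "z \<in> cneg (coset R p)"
  then obtain w where "z = - w" "p - w \<in> free.span R" by (auto simp: cneg_def coset_def)
  then show "z \<in> coset R (- p)"
    using free.span_neg[of "p - w" R] by (simp add: coset_def)
next
  fix z assume "z \<in> coset R (- p)"
  then have "- z \<in> coset R p"
    using free.span_neg[of "- p - z" R] by (simp add: coset_def algebra_simps)
  moreover have "z = - (- z)" by simp
  ultimately show "z \<in> cneg (coset R p)" unfolding cneg_def by blast
qed

lemma cminus_eq_cplus_cneg: "A \<boxminus> B = A \<boxplus> cneg B"
proof (intro equalityI subsetI)
  fix z assume "z \<in> A \<boxminus> B"
  then obtain p q where "p \<in> A" "q \<in> B" "z = p + (- q)" by (auto simp: cminus_def)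
  then show "z \<in> A \<boxplus> cneg B" unfolding cplus_def cneg_def by blast
next
  fix z assume "z \<in> A \<boxplus> cneg B"
  then obtain p q where "p \<in> A" "q \<in> B" "z = p - q" by (auto simp: cplus_def cneg_def)
  then show "z \<in> A \<boxminus> B" unfolding cminus_def by blast
qed

lemma coset_diff: "coset R p \<boxminus> coset R q = coset R (p - q)"
  by (simp add: cminus_eq_cplus_cneg coset_neg coset_add)

lemma cplus_assoc: "A \<boxplus> B \<boxplus> C = A \<boxplus> (B \<boxplus> C)"
proof -
  have "A \<boxplus> B \<boxplus> C = {p + q + r | p q r. p \<in> A \<and> q \<in> B \<and> r \<in> C}"
    unfolding cplus_def by blast
  also have "\<dots> = {p + (q + r) | p q r. p \<in> A \<and> q \<in> B \<and> r \<in> C}"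
    by (simp only: add.assoc)
  also have "\<dots> = A \<boxplus> (B \<boxplus> C)" unfolding cplus_def by blast
  finally show ?thesis .
qed

lemma cplus_commute: "A \<boxplus> B = B \<boxplus> A"
  unfolding cplus_def using add.commute by blast

lemma cplus_left_commute: "A \<boxplus> (B \<boxplus> C) = B \<boxplus> (A \<boxplus> C)"
  by (metis cplus_assoc cplus_commute)

lemmas cplus_ac = cplus_assoc cplus_commute cplus_left_commute

lemma cneg_cneg [simp]: "cneg (cneg A) = A"
  by (simp add: cneg_def image_image)

text \<open>The linear extension of \<open>F\<close> kills the quotient by \<open>S\<close> modulo
  \<open>R\<close>, so it induces a map of quotients. Testing the defining relations is enough, by
  induction over the span.\<close>

definition descends :: "('x \<Rightarrow>\<^sub>0 'k::field) set \<Rightarrow> ('y \<Rightarrow>\<^sub>0 'k) set \<Rightarrow> ('x \<Rightarrow> ('y \<Rightarrow>\<^sub>0 'k)) \<Rightarrow> bool" where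
  "descends S R F \<longleftrightarrow> (\<forall>r\<in>S. lin_ext F r \<in> free.span R)"

lemma descends_span:
  assumes "descends S R F" "r \<in> free.span S"
  shows "lin_ext F r \<in> free.span R"
  using assms(2)
proof (induction rule: free.span_induct_alt)
  case base then show ?case by (simp add: free.span_zero)
next
  case (step c x y)
  then show ?case using assms(1)
    by (auto simp: lin_ext_add lin_ext_fscale descends_def intro!: free.span_add free.span_scale)
qed

lemma descends_eq_mod: "descends S R F \<Longrightarrow> eq_mod S p q \<Longrightarrow> eq_mod R (lin_ext F p) (lin_ext F q)"
  unfolding eq_mod_def using descends_span[of S R F "p - q"] by (simp add: lin_ext_diff)

lemma lin_ext_rep_coset: "descends S R F \<Longrightarrow> eq_mod R (lin_ext F (rep (coset S p))) (lin_ext F p)"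
  by (rule descends_eq_mod[OF _ eq_mod_sym[OF eq_mod_rep_coset]])

lemma lin_ext_in_span:
  "(\<And>x. x \<in> Poly_Mapping.keys p \<Longrightarrow> F x \<in> free.span R) \<Longrightarrow> lin_ext F p \<in> free.span R"
  unfolding lin_ext_def by (intro free.span_sum free.span_scale) auto

lemma eq_mod_lin_ext:
  assumes "\<And>x. x \<in> Poly_Mapping.keys p \<Longrightarrow> eq_mod R (F x) (G x)"
  shows "eq_mod R (lin_ext F p) (lin_ext G p)"
  using assms lin_ext_in_span[of p "\<lambda>x. F x - G x"] by (simp add: eq_mod_def lin_ext_diff_fun)

lemma descends_comp:
  "descends S R F \<Longrightarrow> descends R T G \<Longrightarrow> descends S T (\<lambda>x. lin_ext G (F x))"
  by (auto simp: descends_def lin_ext_lin_ext[symmetric] intro: descends_span)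

text \<open>Serves expressions linear in two variables: one is expanded into finitely many fixed
  terms, and descent in the other is checked for each of them.\<close>

lemma descends_lin_ext:
  assumes "\<And>d. d \<in> Poly_Mapping.keys q \<Longrightarrow> descends S R (F d)"
  shows "descends S R (\<lambda>x. lin_ext (\<lambda>d. F d x) q)"
  unfolding descends_def lin_ext_swap[of _ q]
  using assms by (auto simp: descends_def intro: lin_ext_in_span)

section \<open>Supports of chosen representatives\<close>

definition finsupp :: "'x set \<Rightarrow> ('x \<Rightarrow>\<^sub>0 'k::field) set" where
  "finsupp A = {p. Poly_Mapping.keys p \<subseteq> A}"

lemma subspace_finsupp: "free.subspace (finsupp A :: ('x \<Rightarrow>\<^sub>0 'k::field) set)"
proof (rule free.subspaceI)
  show "0 \<in> finsupp A" by (simp add: finsupp_def)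
next
  fix p q :: "'x \<Rightarrow>\<^sub>0 'k" assume "p \<in> finsupp A" "q \<in> finsupp A"
  then show "p + q \<in> finsupp A"
    using Poly_Mapping.keys_add[of p q] by (auto simp: finsupp_def)
next
  fix c and p :: "'x \<Rightarrow>\<^sub>0 'k" assume "p \<in> finsupp A"
  moreover have "Poly_Mapping.keys (fscale c p) \<subseteq> Poly_Mapping.keys p"
    by (auto simp: in_keys_iff lookup_fscale)
  ultimately show "fscale c p \<in> finsupp A" by (auto simp: finsupp_def)
qed

lemma gen_finsupp: "x \<in> A \<Longrightarrow> Poly_Mapping.single x c \<in> finsupp A"
  by (simp add: finsupp_def)

lemma lin_ext_finsupp:
  "(\<And>x. x \<in> Poly_Mapping.keys p \<Longrightarrow> F x \<in> finsupp A) \<Longrightarrow> lin_ext F p \<in> finsupp A"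
  unfolding lin_ext_def
  by (intro free.subspace_sum[OF subspace_finsupp] free.subspace_scale[OF subspace_finsupp])

text \<open>If the relations are supported in \<open>A\<close>, so is their span, and the chosen
  representative differs from \<open>p\<close> by an element of that span. This tames the arbitrary
  choice in \<open>rep\<close>.\<close>

lemma rep_coset_finsupp:
  assumes "R \<subseteq> finsupp A" "p \<in> finsupp A"
  shows "rep (coset R p) \<in> finsupp A"
proof -
  have "free.span R \<subseteq> finsupp A"
    using assms(1) by (intro free.span_minimal subspace_finsupp)
  then have "p - rep (coset R p) \<in> finsupp A"
    using eq_mod_rep_coset[of R p] by (auto simp: eq_mod_def)
  from free.subspace_diff[OF subspace_finsupp assms(2) this] show ?thesis by simp
qed

section \<open>Tensor powers\<close>

lemma eq_mod_tpow_add: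
  "length a = n \<Longrightarrow> i < n \<Longrightarrow>
    eq_mod (tpow_rels H n) (gen (a[i := u + v])) (gen (a[i := u]) + gen (a[i := v]))"
  unfolding tpow_rels_def by (rule eq_mod_base) (simp only: diff_diff_eq[symmetric], blast)

lemma eq_mod_tpow_scale:
  "length a = n \<Longrightarrow> i < n \<Longrightarrow>
    eq_mod (tpow_rels H n) (gen (a[i := hscale H c u])) (fscale c (gen (a[i := u])))"
  unfolding tpow_rels_def by (rule eq_mod_base) (simp only: fscale_single mult_1_right, blast)

lemma descends_tpowI:
  assumes "\<And>a i u v. length a = n \<Longrightarrow> i < n \<Longrightarrow>
      eq_mod R (F (a[i := u + v])) (F (a[i := u]) + F (a[i := v]))"
    and "\<And>a i c u. length a = n \<Longrightarrow> i < n \<Longrightarrow>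
      eq_mod R (F (a[i := hscale H c u])) (fscale c (F (a[i := u])))"
  shows "descends (tpow_rels H n) R F"
  using assms unfolding descends_def tpow_rels_def
  by (auto simp: lin_ext_diff lin_ext_add eq_mod_def diff_diff_eq)

lemma tpow_rels_finsupp: "tpow_rels H n \<subseteq> finsupp {a. length a = n}"
  unfolding tpow_rels_def
  by (auto intro!: free.subspace_diff[OF subspace_finsupp] gen_finsupp)

definition slotwise_linear :: "('k::field, 'h::ring_1) hopf \<Rightarrow> nat \<Rightarrow> nat \<Rightarrow> ('h list \<Rightarrow> 'h list) \<Rightarrow> bool" where
  "slotwise_linear H n n' P \<longleftrightarrow> (\<forall>a i. length a = n \<longrightarrow> i < n \<longrightarrow> (\<exists>b j L.
      length b = n' \<and> j < n' \<and> (\<forall>u. P (a[i := u]) = b[j := L u])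
      \<and> (\<forall>u v. L (u + v) = L u + L v) \<and> (\<forall>c u. L (hscale H c u) = hscale H c (L u))))"

lemma slotwise_linearI:
  fixes H :: "('k::field, 'h::ring_1) hopf"
  assumes "\<And>a i. length a = n \<Longrightarrow> i < n \<Longrightarrow> length (b a i) = n' \<and> j a i < n'"
    and "\<And>a i u. length a = n \<Longrightarrow> i < n \<Longrightarrow> P (a[i := u]) = (b a i)[j a i := L a i u]"
    and "\<And>a i u v. length a = n \<Longrightarrow> i < n \<Longrightarrow> L a i (u + v) = L a i u + L a i v"
    and "\<And>a i c u. length a = n \<Longrightarrow> i < n \<Longrightarrow> L a i (hscale H c u) = hscale H c (L a i u)"
  shows "slotwise_linear H n n' P"
  unfolding slotwise_linear_def
proof (intro allI impI)
  fix a :: "'h list" and i assume "length a = n" "i < n"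
  with assms show "\<exists>b j L. length b = n' \<and> j < n' \<and> (\<forall>u. P (a[i := u]) = b[j := L u])
      \<and> (\<forall>u v. L (u + v) = L u + L v) \<and> (\<forall>c u. L (hscale H c u) = hscale H c (L u))"
    by (intro exI[of _ "b a i"] exI[of _ "j a i"] exI[of _ "L a i"]) simp
qed

lemma descends_slotwise_linear:
  fixes H :: "('k::field, 'h::ring_1) hopf"
  assumes "slotwise_linear H n n' P"
  shows "descends (tpow_rels H n) (tpow_rels H n') (\<lambda>a. gen (P a))"
proof (rule descends_tpowI)
  fix a :: "'h list" and i u v c assume "length a = n" "i < n"
  then obtain b j L where b: "length b = n'" "j < n'" and L: "\<And>u. P (a[i := u]) = b[j := L u]"
    "\<And>u v. L (u + v) = L u + L v" "\<And>c u. L (hscale H c u) = hscale H c (L u)"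
    using assms unfolding slotwise_linear_def by metis
  show "eq_mod (tpow_rels H n') (gen (P (a[i := u + v]))) (gen (P (a[i := u])) + gen (P (a[i := v])))"
    unfolding L by (rule eq_mod_tpow_add[OF b])
  show "eq_mod (tpow_rels H n') (gen (P (a[i := hscale H c u]))) (fscale c (gen (P (a[i := u]))))"
    unfolding L by (rule eq_mod_tpow_scale[OF b])
qed

section \<open>Exchange of the first two slots\<close>

definition swap01 :: "'x list \<Rightarrow> 'x list" where
  "swap01 a = a ! 1 # a ! 0 # drop 2 a"

lemma length_swap01: "2 \<le> length a \<Longrightarrow> length (swap01 a) = length a"
  by (simp add: swap01_def)

lemma swap01_swap01: "2 \<le> length a \<Longrightarrow> swap01 (swap01 a) = a"
  by (cases a; cases "tl a") (auto simp: swap01_def)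

lemma swap01_map2:
  assumes "2 \<le> length a" "length b = length a"
  shows "swap01 (map2 f a b) = map2 f (swap01 a) (swap01 b)"
  using assms by (cases a; cases "tl a"; cases b; cases "tl b") (auto simp: swap01_def)

lemma slotwise_linear_swap01:
  assumes "2 \<le> n"
  shows "slotwise_linear H n n swap01"
  using assms
  by (intro slotwise_linearI[where b = "\<lambda>a i. swap01 a"
        and j = "\<lambda>a i. if i = 0 then 1 else if i = 1 then 0 else i" and L = "\<lambda>a i u. u"])
    (auto intro!: nth_equalityI simp: swap01_def nth_Cons nth_list_update split: nat.splits)

lemma tpow_cases:
  assumes "A \<in> tpow H n"
  shows "rep A \<in> finsupp {a. length a = n}" "tpow_class H n (rep A) = A"
  using assms rep_coset_finsupp[OF tpow_rels_finsupp[where n = n and H = H]]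
  by (auto simp: tpow_def finsupp_def)

lemma tpow_classI: "p \<in> finsupp {a. length a = n} \<Longrightarrow> tpow_class H n p \<in> tpow H n"
  by (auto simp: tpow_def finsupp_def)

text \<open>Replacing slot \<open>m\<close> by the list \<open>e\<close> leaves earlier entries in
  place and shifts later ones by \<open>length e - 1\<close>. In the second case \<open>i\<close>
  exceeds \<open>m\<close>, so the truncated subtraction does no harm.\<close>

lemma insert_list_update:
  assumes "i \<noteq> m" "i < length f" "m < length f"
  shows "take m (f[i := w]) @ e @ drop (Suc m) (f[i := w])
    = (take m f @ e @ drop (Suc m) f)[if i < m then i else i + length e - 1 := w]"
proof (cases "i < m")
  case True
  with assms show ?thesis by (simp add: list_update_append take_update_swap)
next
  case False
  with assms obtain j where "i = Suc m + j" using less_iff_Suc_add[of m i] by auto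
  with assms show ?thesis by (simp add: list_update_append drop_update_swap)
qed

lemma map2_mult_assoc:
  fixes a b c :: "'h::semigroup_mult list"
  shows "map2 (*) (map2 (*) a b) c = map2 (*) a (map2 (*) b c)"
  by (auto intro!: nth_equalityI simp: mult.assoc)

lemma map2_mult_one: "length d = 2 \<Longrightarrow> map2 (*) [1, 1] d = (d :: 'h::monoid_mult list)"
  by (auto simp: length_Suc_conv numeral_2_eq_2)

context cocommutative_hopf_algebra
begin

lemma slotwise_linear_lmult:
  "length c = n \<Longrightarrow> slotwise_linear H n n (map2 (*) c)"
  by (intro slotwise_linearI[where b = "\<lambda>a i. map2 (*) c a" and j = "\<lambda>a i. i"
        and L = "\<lambda>a i u. c ! i * u"])
    (auto intro!: nth_equalityI simp: nth_list_update distrib_left mult_scale_right)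

lemma slotwise_linear_rmult:
  "length d = n \<Longrightarrow> slotwise_linear H n n (\<lambda>a. map2 (*) a d)"
  by (intro slotwise_linearI[where b = "\<lambda>a i. map2 (*) a d" and j = "\<lambda>a i. i"
        and L = "\<lambda>a i u. u * d ! i"])
    (auto intro!: nth_equalityI simp: nth_list_update distrib_right mult_scale_left)

lemma slotwise_linear_insert:
  assumes "slotwise_linear H k k P" "length f = n" "m < n"
  shows "slotwise_linear H k (n + k - 1) (\<lambda>d. take m f @ P d @ drop (Suc m) f)"
  unfolding slotwise_linear_def
proof (intro allI impI)
  fix a :: "'h list" and i assume "length a = k" "i < k"
  then obtain b j L where b: "length b = k" "j < k" and L: "\<And>u. P (a[i := u]) = b[j := L u]"
    "\<And>u v. L (u + v) = L u + L v" "\<And>c u. L (hscale H c u) = hscale H c (L u)"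
    using assms unfolding slotwise_linear_def by metis
  have "take m f @ b[j := u] @ drop (Suc m) f = (take m f @ b @ drop (Suc m) f)[m + j := u]" for u
    using b assms by (simp add: list_update_append)
  then show "\<exists>b j L. length b = n + k - 1 \<and> j < n + k - 1
      \<and> (\<forall>u. take m f @ P (a[i := u]) @ drop (Suc m) f = b[j := L u])
      \<and> (\<forall>u v. L (u + v) = L u + L v) \<and> (\<forall>c u. L (hscale H c u) = hscale H c (L u))"
    using b L assms
    by (intro exI[of _ "take m f @ b @ drop (Suc m) f"] exI[of _ "m + j"] exI[of _ L]) auto
qed

section \<open>The coproduct of one slot, on representatives\<close>

lemma rep_comult_finsupp: "rep (comult H h) \<in> finsupp {a. length a = 2}"
  by (rule tpow_cases(1)[OF comult_closed])

lemma length_keys_comult: "d \<in> Poly_Mapping.keys (rep (comult H h)) \<Longrightarrow> length d = 2"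
  using rep_comult_finsupp[of h] by (auto simp: finsupp_def)

lemma tpow_class_rep_comult [simp]: "tpow_class H 2 (rep (comult H h)) = comult H h"
  by (rule tpow_cases(2)[OF comult_closed])

lemma rep_comult_add:
  "eq_mod (tpow_rels H 2) (rep (comult H (u + v))) (rep (comult H u) + rep (comult H v))"
  unfolding coset_eq_iff[symmetric] coset_add[symmetric] tpow_class_rep_comult by (rule comult_add)

lemma rep_comult_scale:
  "eq_mod (tpow_rels H 2) (rep (comult H (hscale H c u))) (fscale c (rep (comult H u)))"
  unfolding coset_eq_iff[symmetric] tpow_class_rep_comult by (rule comult_scale)

lemma rep_comult_mult:
  "eq_mod (tpow_rels H 2) (rep (comult H (u * v)))
     (lin_ext (\<lambda>a. lin_ext (\<lambda>b. gen (map2 (*) a b)) (rep (comult H v))) (rep (comult H u)))"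
  unfolding coset_eq_iff[symmetric] tpow_class_rep_comult tpow_mult_def[symmetric] by (rule comult_mult)

text \<open>The coproduct of one factor and a left multiplication are fused: with
  \<open>h = [1, 1]\<close> this is the map behind \<open>comult_at\<close>, and with
  \<open>h\<close> taken from an inserted element it is the effect of a substitution on the factors
  in \<open>H\<close>. One descent proof covers both.\<close>

definition coslot :: "nat \<Rightarrow> 'h list \<Rightarrow> 'h list \<Rightarrow> ('h list \<Rightarrow>\<^sub>0 'k)" where
  "coslot m h f = lin_ext (\<lambda>d. gen (take m f @ map2 (*) h d @ drop (Suc m) f)) (rep (comult H (f ! m)))"

lemma descends_insert:
  assumes "length h = 2" "length f = n" "m < n"
  shows "descends (tpow_rels H 2) (tpow_rels H (Suc n))
    (\<lambda>d. gen (take m f @ map2 (*) h d @ drop (Suc m) f))"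
  using descends_slotwise_linear[OF slotwise_linear_insert[OF slotwise_linear_lmult[OF assms(1)] assms(2,3)]]
  by simp

text \<open>If the varied entry is in slot \<open>m\<close>, linearity of the coproduct applies; any
  other entry is carried unchanged into a slot of the longer list, where the relations hold term by
  term.\<close>

lemma descends_coslot:
  assumes h: "length h = 2" and m: "m < n"
  shows "descends (tpow_rels H n) (tpow_rels H (Suc n)) (coslot m h)"
proof (rule descends_tpowI)
  fix f :: "'h list" and i u v c assume f: "length f = n" "i < n"
  let ?K = "\<lambda>d. gen (take m f @ map2 (*) h d @ drop (Suc m) f)"
  let ?P = "\<lambda>d f. take m f @ map2 (*) h d @ drop (Suc m) f"
  \<comment> \<open>Slot \<open>m\<close> becomes two slots, so an entry behind it moves one place
    to the right.\<close>
  let ?j = "if i < m then i else Suc i"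
  note K = descends_insert[OF h f(1) m]
  have same: "coslot m h (f[m := w]) = lin_ext ?K (rep (comult H w))" for w
    using f m by (simp add: coslot_def)
  have other: "coslot m h (f[i := w]) = lin_ext (\<lambda>d. gen ((?P d f)[?j := w])) (rep (comult H (f ! m)))"
    if "i \<noteq> m" for w
  proof -
    have nth: "(f[i := w]) ! m = f ! m" using that by simp
    have upd: "?P d (f[i := w]) = (?P d f)[?j := w]"
      if "d \<in> Poly_Mapping.keys (rep (comult H (f ! m)))" for d
      using insert_list_update[OF \<open>i \<noteq> m\<close>, where f = f and e = "map2 (*) h d" and w = w] f m h length_keys_comult[OF that] by simp
    show ?thesis
      unfolding coslot_def nth by (rule lin_ext_cong, rule arg_cong[of _ _ gen], rule upd)
  qed
  have len: "length (?P d f) = Suc n" "?j < Suc n" if "d \<in> Poly_Mapping.keys (rep (comult H (f ! m)))" for d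
    using f m h length_keys_comult[OF that] by auto
  show "eq_mod (tpow_rels H (Suc n)) (coslot m h (f[i := u + v])) (coslot m h (f[i := u]) + coslot m h (f[i := v]))"
  proof (cases "i = m")
    case True
    then show ?thesis
      using descends_eq_mod[OF K rep_comult_add[of u v]] by (simp add: same lin_ext_add)
  next
    case False
    show ?thesis
      unfolding other[OF False] lin_ext_add_fun[symmetric]
      by (rule eq_mod_lin_ext) (rule eq_mod_tpow_add, use len in auto)
  qed
  show "eq_mod (tpow_rels H (Suc n)) (coslot m h (f[i := hscale H c u])) (fscale c (coslot m h (f[i := u])))"
  proof (cases "i = m")
    case True
    then show ?thesis
      using descends_eq_mod[OF K rep_comult_scale[of c u]] by (simp add: same lin_ext_fscale)
  next
    case False
    show ?thesis
      unfolding other[OF False] lin_ext_fscale_fun[symmetric]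
      by (rule eq_mod_lin_ext) (rule eq_mod_tpow_scale, use len in auto)
  qed
qed

text \<open>Multiplicativity of the coproduct in slot \<open>m\<close>, and associativity of
  multiplication in all slots, pull the right factor \<open>b\<close> out of \<open>coslot\<close>.
  In this way a coproduct multiplied from the right passes through a substitution.\<close>

lemma coslot_mult:
  assumes h: "length h = 2" and m: "m < n" and a: "length a = n" and b: "length b = n"
  shows "eq_mod (tpow_rels H (Suc n)) (coslot m h (map2 (*) a b))
    (lin_ext (\<lambda>d. lin_ext (\<lambda>d'. gen (map2 (*) (take m a @ map2 (*) h d @ drop (Suc m) a) d'))
       (coslot m [1, 1] b)) (rep (comult H (a ! m))))"
proof -
  let ?K = "\<lambda>d. gen (take m (map2 (*) a b) @ map2 (*) h d @ drop (Suc m) (map2 (*) a b))"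
  have "descends (tpow_rels H 2) (tpow_rels H (Suc n)) ?K"
    using assms by (intro descends_insert) auto
  from descends_eq_mod[OF this rep_comult_mult[of "a ! m" "b ! m"]]
  have "eq_mod (tpow_rels H (Suc n)) (coslot m h (map2 (*) a b))
     (lin_ext (\<lambda>d. lin_ext (\<lambda>d'. ?K (map2 (*) d d')) (rep (comult H (b ! m)))) (rep (comult H (a ! m))))"
    using assms by (simp add: coslot_def lin_ext_lin_ext)
  also have "lin_ext (\<lambda>d. lin_ext (\<lambda>d'. ?K (map2 (*) d d')) (rep (comult H (b ! m)))) (rep (comult H (a ! m)))
    = lin_ext (\<lambda>d. lin_ext (\<lambda>d'. gen (map2 (*) (take m a @ map2 (*) h d @ drop (Suc m) a) d'))
       (coslot m [1, 1] b)) (rep (comult H (a ! m)))"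
    unfolding coslot_def lin_ext_lin_ext lin_ext_single free.scale_one
  proof (intro lin_ext_cong arg_cong[of _ _ gen])
    fix d d' assume "d \<in> Poly_Mapping.keys (rep (comult H (a ! m)))" "d' \<in> Poly_Mapping.keys (rep (comult H (b ! m)))"
    then have "length d = 2" "length d' = 2" by (auto dest: length_keys_comult)
    with assms show "take m (map2 (*) a b) @ map2 (*) h (map2 (*) d d') @ drop (Suc m) (map2 (*) a b)
      = map2 (*) (take m a @ map2 (*) h d @ drop (Suc m) a) (take m b @ map2 (*) [1, 1] d' @ drop (Suc m) b)"
      by (simp add: map2_mult_one take_map take_zip drop_map drop_zip map2_mult_assoc)
  qed
  finally show ?thesis .
qed

lemma comult_at_eq_coslot: "comult_at H n m A = tpow_class H (Suc n) (lin_ext (coslot m [1, 1]) (rep A))"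
  unfolding comult_at_def coslot_def
  by (intro arg_cong[of _ _ "tpow_class H (Suc n)"] lin_ext_cong arg_cong[of _ _ gen])
    (auto dest!: length_keys_comult simp: map2_mult_one)

lemma coslot_finsupp:
  "length h = 2 \<Longrightarrow> m < n \<Longrightarrow> length f = n \<Longrightarrow> coslot m h f \<in> finsupp {a. length a = Suc n}"
  unfolding coslot_def by (intro lin_ext_finsupp gen_finsupp) (auto dest: length_keys_comult)

lemma comult_at_closed: "m < n \<Longrightarrow> A \<in> tpow H n \<Longrightarrow> comult_at H n m A \<in> tpow H (Suc n)"
  unfolding comult_at_eq_coslot
  using tpow_cases(1)[of A H n]
  by (intro tpow_classI lin_ext_finsupp coslot_finsupp) (auto simp: finsupp_def)

section \<open>Iterated coproducts\<close>

lemma iter_comult_closed: "iter_comult H n h \<in> tpow H n"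
proof (induction n)
  case 0 then show ?case by (auto intro!: tpow_classI gen_finsupp)
next
  case (Suc n)
  then show ?case
    by (cases n) (auto intro!: tpow_classI gen_finsupp comult_at_closed)
qed

text \<open>The recursion applies \<open>comult_at\<close> to the chosen representative of the class
  of \<open>[h]\<close>; descent of \<open>coslot\<close> allows \<open>[h]\<close> itself to be
  used instead.\<close>

lemma iter_comult_2: "iter_comult H 2 h = comult H h"
proof -
  have "descends (tpow_rels H 1) (tpow_rels H 2) (coslot 0 [1, 1])"
    using descends_coslot[of "[1, 1]" 0 1] by (simp add: numeral_2_eq_2)
  from lin_ext_rep_coset[OF this]
  have "tpow_class H 2 (lin_ext (coslot 0 [1, 1]) (rep (tpow_class H 1 (gen [h]))))
      = tpow_class H 2 (lin_ext (coslot 0 [1, 1]) (gen [h]))"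
    by (simp only: coset_eq_iff)
  also have "lin_ext (coslot 0 [1, 1]) (gen [h]) = lin_ext gen (rep (comult H h))"
    unfolding lin_ext_single free.scale_one coslot_def nth_Cons_0
    by (intro lin_ext_cong) (auto dest!: length_keys_comult simp: map2_mult_one)
  finally show ?thesis
    by (simp add: numeral_2_eq_2 comult_at_eq_coslot tpow_class_rep_comult[unfolded numeral_2_eq_2])
qed

text \<open>The recursion always splits slot 0, whereas a substitution splits the slot
  \<open>m\<close> into which it inserts; coassociativity identifies the results.\<close>

lemma iter_comult_3:
  assumes "m < 2"
  shows "iter_comult H 3 h = comult_at H 2 m (comult H h)"
proof -
  have "iter_comult H 3 h = comult_at H 2 0 (iter_comult H 2 h)"
    by (simp add: numeral_2_eq_2 numeral_3_eq_3)
  also have "\<dots> = comult_at H 2 m (comult H h)"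
    using assms coassoc by (auto simp: iter_comult_2 less_2_cases_iff)
  finally show ?thesis .
qed

lemma coslot_swap:
  assumes f: "length f = Suc n"
  shows "eq_mod (tpow_rels H (Suc (Suc n))) (lin_ext (\<lambda>a. gen (swap01 a)) (coslot 0 [1, 1] f))
    (coslot 0 [1, 1] f)"
proof -
  let ?K = "\<lambda>d. gen (take 0 f @ map2 (*) [1, 1] d @ drop (Suc 0) f)"
  have K: "descends (tpow_rels H 2) (tpow_rels H (Suc (Suc n))) ?K"
    by (rule descends_insert) (use f in auto)
  \<comment> \<open>Reversing a list of length two is the exchange of its entries, so the exchange
    after insertion at slot 0 comes from the reversal in the cocommutativity axiom.\<close>
  have "lin_ext (\<lambda>a. gen (swap01 a)) (coslot 0 [1, 1] f)
      = lin_ext ?K (lin_ext (\<lambda>d. gen (rev d)) (rep (comult H (f ! 0))))"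
    unfolding coslot_def lin_ext_lin_ext lin_ext_single free.scale_one
    by (intro lin_ext_cong)
      (auto dest!: length_keys_comult simp: swap01_def length_Suc_conv numeral_2_eq_2)
  moreover have "eq_mod (tpow_rels H 2) (lin_ext (\<lambda>d. gen (rev d)) (rep (comult H (f ! 0)))) (rep (comult H (f ! 0)))"
    unfolding coset_eq_iff[symmetric] tpow_class_rep_comult by (rule cocommutative)
  ultimately show ?thesis
    using descends_eq_mod[OF K] by (simp add: coslot_def)
qed

text \<open>The last step of the recursion splits slot 0, so the first two factors are the coproduct
  of a single factor, and one application of cocommutativity suffices.\<close>

lemma iter_comult_swap:
  assumes "2 \<le> n"
  shows "eq_mod (tpow_rels H n) (lin_ext (\<lambda>a. gen (swap01 a)) (rep (iter_comult H n h))) (rep (iter_comult H n h))"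
proof -
  obtain k where n: "n = Suc (Suc k)"
    using assms by (metis add_2_eq_Suc le_Suc_ex)
  let ?A = "rep (iter_comult H (Suc k) h)"
  let ?S = "\<lambda>a :: 'h list. gen (swap01 a) :: 'h list \<Rightarrow>\<^sub>0 'k"
  let ?C = "lin_ext (coslot 0 [1, 1]) ?A"
  have it: "iter_comult H n h = tpow_class H n ?C"
    by (simp add: n comult_at_eq_coslot)
  have len: "length a = Suc k" if "a \<in> Poly_Mapping.keys ?A" for a
    using tpow_cases(1)[OF iter_comult_closed[of "Suc k" h]] that by (auto simp: finsupp_def)
  have "eq_mod (tpow_rels H n) (lin_ext ?S (rep (iter_comult H n h))) (lin_ext ?S ?C)"
    unfolding it by (rule lin_ext_rep_coset[OF descends_slotwise_linear[OF slotwise_linear_swap01[OF assms]]])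
  also have "eq_mod (tpow_rels H n) (lin_ext ?S ?C) ?C"
    unfolding n lin_ext_lin_ext by (intro eq_mod_lin_ext coslot_swap len)
  also have "eq_mod (tpow_rels H n) ?C (rep (iter_comult H n h))"
    unfolding it by (rule eq_mod_rep_coset)
  finally show ?thesis .
qed

end

section \<open>Induced maps\<close>

lemma eq_mod_tens_add:
  assumes "length a = n" "x \<in> carrier M" "y \<in> carrier M"
  shows "eq_mod (tens_rels H n M) (gen (a, x \<oplus>\<^bsub>M\<^esub> y)) (gen (a, x) + gen (a, y))"
  unfolding tens_rels_def using assms
  by (intro eq_mod_base) (simp only: diff_diff_eq[symmetric], blast)

lemma eq_mod_tens_smult:
  assumes "length a = n" "x \<in> carrier M"
  shows "eq_mod (tens_rels H n M) (gen (a, h \<odot>\<^bsub>M\<^esub> x))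
    (lin_ext (\<lambda>d. gen (map2 (*) a d, x)) (rep (iter_comult H n h)))"
  unfolding tens_rels_def using assms by (intro eq_mod_base) blast

lemma descends_pair:
  assumes "x \<in> carrier M"
  shows "descends (tpow_rels H n) (tens_rels H n M) (\<lambda>a. gen (a, x))"
  unfolding descends_def tens_rels_def using assms by (blast intro: free.span_base)

lemma descends_tensI:
  assumes "\<And>x. x \<in> carrier M \<Longrightarrow> descends (tpow_rels H n) R (\<lambda>a. F (a, x))"
    and "\<And>a x y. length a = n \<Longrightarrow> x \<in> carrier M \<Longrightarrow> y \<in> carrier M \<Longrightarrow>
      eq_mod R (F (a, x \<oplus>\<^bsub>M\<^esub> y)) (F (a, x) + F (a, y))"
    and "\<And>a h x. length a = n \<Longrightarrow> x \<in> carrier M \<Longrightarrow>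
      eq_mod R (F (a, h \<odot>\<^bsub>M\<^esub> x)) (lin_ext (\<lambda>d. F (map2 (*) a d, x)) (rep (iter_comult H n h)))"
  shows "descends (tens_rels H n M) R F"
  unfolding descends_def
proof
  fix r assume "r \<in> tens_rels H n M"
  then consider (tpow) s x where "r = lin_ext (\<lambda>a. gen (a, x)) s" "s \<in> tpow_rels H n" "x \<in> carrier M"
    | (add) a x y where "r = gen (a, x \<oplus>\<^bsub>M\<^esub> y) - gen (a, x) - gen (a, y)" "length a = n"
        "x \<in> carrier M" "y \<in> carrier M"
    | (smult) a h x where "r = gen (a, h \<odot>\<^bsub>M\<^esub> x)
          - lin_ext (\<lambda>d. gen (map2 (*) a d, x)) (rep (iter_comult H n h))" "length a = n" "x \<in> carrier M"
    unfolding tens_rels_def by blast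
  then show "lin_ext F r \<in> free.span R"
  proof cases
    case tpow
    then show ?thesis using assms(1)[of x] by (auto simp: descends_def lin_ext_lin_ext)
  next
    case add
    then show ?thesis using assms(2)[of a x y] by (simp add: eq_mod_def lin_ext_diff lin_ext_add diff_diff_eq)
  next
    case smult
    then show ?thesis using assms(3)[of a x h] by (simp add: eq_mod_def lin_ext_diff lin_ext_lin_ext)
  qed
qed

abbreviation tens_supp :: "nat \<Rightarrow> ('h, 'm) module \<Rightarrow> ('h list \<times> 'm \<Rightarrow>\<^sub>0 'k::field) set" where
  "tens_supp n M \<equiv> finsupp ({a. length a = n} \<times> carrier M)"

lemma tens_classI: "p \<in> tens_supp n M \<Longrightarrow> tens_class H n M p \<in> tens H n M"
  by (auto simp: tens_def finsupp_def)

text \<open>Common form of \<open>tens_map\<close>, \<open>tens_lmult\<close>,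
  \<open>arrange\<close> and \<open>plug\<close>, so that closure, additivity and composition are
  proved once.\<close>

definition induced :: "('k::field, 'h::ring_1) hopf \<Rightarrow> nat \<Rightarrow> ('h, 'n) module
    \<Rightarrow> ('h list \<times> 'm \<Rightarrow> ('h list \<times> 'n \<Rightarrow>\<^sub>0 'k))
    \<Rightarrow> ('h list \<times> 'm \<Rightarrow>\<^sub>0 'k) set \<Rightarrow> ('h list \<times> 'n \<Rightarrow>\<^sub>0 'k) set" where
  "induced H n' N F A = tens_class H n' N (lin_ext F (rep A))"

text \<open>Descent makes the induced map independent of representatives; the support condition
  makes it land in \<open>tens H n' N\<close> and not merely among cosets of the relations.\<close>

definition tens_hom :: "('k::field, 'h::ring_1) hopf \<Rightarrow> nat \<Rightarrow> ('h, 'm) module \<Rightarrow> nat \<Rightarrow> ('h, 'n) module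
    \<Rightarrow> ('h list \<times> 'm \<Rightarrow> ('h list \<times> 'n \<Rightarrow>\<^sub>0 'k)) \<Rightarrow> bool" where
  "tens_hom H n M n' N F \<longleftrightarrow> descends (tens_rels H n M) (tens_rels H n' N) F
     \<and> (\<forall>a x. length a = n \<longrightarrow> x \<in> carrier M \<longrightarrow> F (a, x) \<in> tens_supp n' N)"

lemma induced_class:
  "tens_hom H n M n' N F \<Longrightarrow> induced H n' N F (tens_class H n M p) = tens_class H n' N (lin_ext F p)"
  by (simp add: induced_def tens_hom_def coset_eq_iff lin_ext_rep_coset)

lemma tensE:
  assumes "A \<in> tens H n M"
  obtains p where "A = tens_class H n M p" "p \<in> tens_supp n M"
  using assms by (auto simp: tens_def finsupp_def)

lemma tens_hom_supp:
  assumes "tens_hom H n M n' N F" "p \<in> tens_supp n M"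
  shows "lin_ext F p \<in> tens_supp n' N"
  using assms by (intro lin_ext_finsupp) (auto simp: tens_hom_def finsupp_def)

lemma induced_closed:
  assumes "tens_hom H n M n' N F" "A \<in> tens H n M"
  shows "induced H n' N F A \<in> tens H n' N"
  using assms by (auto elim!: tensE simp: induced_class intro!: tens_classI tens_hom_supp)

lemma induced_add:
  assumes "tens_hom H n M n' N F" "A \<in> tens H n M" "B \<in> tens H n M"
  shows "induced H n' N F (A \<boxplus> B) = induced H n' N F A \<boxplus> induced H n' N F B"
  using assms by (auto elim!: tensE simp: induced_class coset_add lin_ext_add)

lemma induced_neg:
  assumes "tens_hom H n M n' N F" "A \<in> tens H n M"
  shows "induced H n' N F (cneg A) = cneg (induced H n' N F A)"
  using assms by (auto elim!: tensE simp: induced_class coset_neg lin_ext_uminus)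

lemma induced_diff:
  assumes "tens_hom H n M n' N F" "A \<in> tens H n M" "B \<in> tens H n M"
  shows "induced H n' N F (A \<boxminus> B) = induced H n' N F A \<boxminus> induced H n' N F B"
  using assms by (auto elim!: tensE simp: induced_class coset_diff lin_ext_diff)

lemma induced_zero:
  "tens_hom H n M n' N F \<Longrightarrow> induced H n' N F (tens_class H n M 0) = tens_class H n' N 0"
  by (simp add: induced_class)

text \<open>Both sides start from the same \<open>rep A\<close>; the representative chosen between
  the two maps is absorbed by the descent of \<open>G\<close>.\<close>

lemma induced_induced:
  assumes "tens_hom H n' N n'' K G"
  shows "induced H n'' K G (induced H n' N F A) = induced H n'' K (\<lambda>x. lin_ext G (F x)) A"
  unfolding induced_def[of H n' N F] induced_class[OF assms]
  by (simp add: induced_def lin_ext_lin_ext)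

lemma tens_class_add_closed:
  "A \<in> tens H n M \<Longrightarrow> B \<in> tens H n M \<Longrightarrow> A \<boxplus> B \<in> tens H n M"
  by (auto elim!: tensE simp: coset_add intro!: tens_classI free.subspace_add[OF subspace_finsupp])

lemma tens_class_diff_closed:
  "A \<in> tens H n M \<Longrightarrow> B \<in> tens H n M \<Longrightarrow> A \<boxminus> B \<in> tens H n M"
  by (auto elim!: tensE simp: coset_diff intro!: tens_classI free.subspace_diff[OF subspace_finsupp])

lemma tens_class_rep [simp]: "A \<in> tens H n M \<Longrightarrow> tens_class H n M (rep A) = A"
  by (auto simp: tens_def)

lemma cplus_zero: "A \<in> tens H n M \<Longrightarrow> A \<boxplus> tens_class H n M 0 = A"
  "A \<in> tens H n M \<Longrightarrow> tens_class H n M 0 \<boxplus> A = A"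
  by (auto elim!: tensE simp: coset_add)

lemma cminus_self: "A \<in> tens H n M \<Longrightarrow> A \<boxminus> A = tens_class H n M 0"
  by (auto elim!: tensE simp: coset_diff)

lemma cneg_add: "A \<in> tens H n M \<Longrightarrow> B \<in> tens H n M \<Longrightarrow> cneg (A \<boxplus> B) = cneg A \<boxplus> cneg B"
  by (auto elim!: tensE simp: coset_add coset_neg)

lemma zero_tens: "tens_class H n M 0 \<in> tens H n M"
  by (intro tens_classI) (simp add: finsupp_def)

context cocommutative_hopf_algebra
begin

lemma tens_rels_finsupp:
  assumes "left_module M"
  shows "tens_rels H n M \<subseteq> tens_supp n M"
proof -
  interpret left_module M by fact
  interpret M: abelian_group M by (rule abelian_group)
  have "lin_ext (\<lambda>a. gen (a, x)) r \<in> tens_supp n M" if "r \<in> tpow_rels H n" "x \<in> carrier M" for r x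
    using that subsetD[OF tpow_rels_finsupp that(1)] by (intro lin_ext_finsupp gen_finsupp) (auto simp: finsupp_def)
  moreover have "lin_ext (\<lambda>d. gen (map2 (*) a d, x)) (rep (iter_comult H n h)) \<in> tens_supp n M"
    if "length a = n" "x \<in> carrier M" for a h x
    using that tpow_cases(1)[OF iter_comult_closed[of n h]] by (intro lin_ext_finsupp gen_finsupp) (auto simp: finsupp_def)
  ultimately show ?thesis
    unfolding tens_rels_def
    by (auto intro!: free.subspace_diff[OF subspace_finsupp] gen_finsupp smult_closed)
qed

lemma rep_tens_supp:
  assumes "left_module M" "A \<in> tens H n M"
  shows "rep A \<in> tens_supp n M"
  using assms(2) by (auto elim!: tensE intro!: rep_coset_finsupp[OF tens_rels_finsupp[OF assms(1)]])

text \<open>The representative of \<open>A\<close> is supported on lists of length \<open>n\<close>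
  and elements of the carrier, so only such generators need comparison. This is the main device for
  proving identities between operations.\<close>

lemma induced_cong:
  assumes "left_module M" "A \<in> tens H n M"
    and "\<And>a x. length a = n \<Longrightarrow> x \<in> carrier M \<Longrightarrow> eq_mod (tens_rels H n' N) (F (a, x)) (G (a, x))"
  shows "induced H n' N F A = induced H n' N G A"
  unfolding induced_def coset_eq_iff
  using rep_tens_supp[OF assms(1,2)] assms(3) by (intro eq_mod_lin_ext) (auto simp: finsupp_def)

lemma induced_id:
  assumes "left_module M" "A \<in> tens H n M" "\<And>a x. length a = n \<Longrightarrow> x \<in> carrier M \<Longrightarrow> F (a, x) = gen (a, x)"
  shows "induced H n M F A = A"
proof -
  have "induced H n M F A = induced H n M gen A"
    using assms by (intro induced_cong) auto
  then show ?thesis using assms(2) by (simp add: induced_def)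
qed

text \<open>Multilinearity takes care of the tensor relations. What remains is balancing over
  \<open>H\<close>, expressed by \<open>comm\<close>: applying \<open>P\<close> before or after
  right multiplication by the iterated coproduct must give congruent results.\<close>

lemma tens_hom_slotwise:
  assumes P: "slotwise_linear H n n P" and len: "\<And>a. length a = n \<Longrightarrow> length (P a) = n"
    and comm: "\<And>a h x. length a = n \<Longrightarrow> x \<in> carrier M \<Longrightarrow>
      eq_mod (tens_rels H n M) (lin_ext (\<lambda>d. gen (map2 (*) (P a) d, x)) (rep (iter_comult H n h)))
        (lin_ext (\<lambda>d. gen (P (map2 (*) a d), x)) (rep (iter_comult H n h)))"
  shows "tens_hom H n M n M (\<lambda>(a, x). gen (P a, x))"
  unfolding tens_hom_def
proof (intro conjI descends_tensI)
  fix x assume "x \<in> carrier M"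
  from descends_comp[OF descends_slotwise_linear[OF P] descends_pair[OF this]]
  show "descends (tpow_rels H n) (tens_rels H n M) (\<lambda>a. case (a, x) of (a, x) \<Rightarrow> gen (P a, x))"
    by simp
next
  fix a :: "'h list" and h x assume "length a = n" "x \<in> carrier M"
  with eq_mod_trans[OF eq_mod_tens_smult comm] len
  show "eq_mod (tens_rels H n M) (case (a, h \<odot>\<^bsub>M\<^esub> x) of (a, x) \<Rightarrow> gen (P a, x))
      (lin_ext (\<lambda>d. case (map2 (*) a d, x) of (a, x) \<Rightarrow> gen (P a, x)) (rep (iter_comult H n h)))"
    by simp
qed (auto intro: eq_mod_tens_add gen_finsupp simp: len)

text \<open>The exchange is multiplicative, so exchanging a product with the iterated coproduct
  exchanges both factors, and the coproduct is invariant by cocommutativity.\<close>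

lemma tens_hom_swap01:
  assumes "2 \<le> n"
  shows "tens_hom H n M n M (\<lambda>(a, x). gen (swap01 a, x))"
proof (rule tens_hom_slotwise[OF slotwise_linear_swap01[OF assms]])
  fix a :: "'h list" and h x assume a: "length a = n" and x: "x \<in> carrier M"
  let ?A = "rep (iter_comult H n h)"
  let ?E = "\<lambda>d. gen (map2 (*) (swap01 a) d, x)"
  have len: "length d = n" if "d \<in> Poly_Mapping.keys ?A" for d
    using tpow_cases(1)[OF iter_comult_closed[of n h]] that by (auto simp: finsupp_def)
  have "descends (tpow_rels H n) (tens_rels H n M) (\<lambda>d. lin_ext (\<lambda>b. gen (b, x)) (gen (map2 (*) (swap01 a) d)))"
    using a assms by (intro descends_comp[OF descends_slotwise_linear[OF slotwise_linear_lmult] descends_pair[OF x]])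
        (simp add: length_swap01)
  then have "descends (tpow_rels H n) (tens_rels H n M) ?E"
    by simp
  from eq_mod_sym[OF descends_eq_mod[OF this iter_comult_swap[OF assms]]]
  have "eq_mod (tens_rels H n M) (lin_ext ?E ?A) (lin_ext (\<lambda>d. ?E (swap01 d)) ?A)"
    by (simp add: lin_ext_lin_ext)
  also have "lin_ext (\<lambda>d. ?E (swap01 d)) ?A = lin_ext (\<lambda>d. gen (swap01 (map2 (*) a d), x)) ?A"
    using assms a by (intro lin_ext_cong) (simp add: swap01_map2 len)
  finally show "eq_mod (tens_rels H n M) (lin_ext ?E ?A) (lin_ext (\<lambda>d. gen (swap01 (map2 (*) a d), x)) ?A)" .
qed (use assms in \<open>simp add: length_swap01\<close>)

lemma tens_hom_lmult:
  assumes "length c = n"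
  shows "tens_hom H n M n M (\<lambda>(a, x). gen (map2 (*) c a, x))"
  using assms by (intro tens_hom_slotwise slotwise_linear_lmult) (simp_all add: map2_mult_assoc)

lemma tens_hom_map:
  assumes "H_linear M N g"
  shows "tens_hom H n M n N (\<lambda>(a, x). gen (a, g x))"
  unfolding tens_hom_def
proof (intro conjI descends_tensI)
  fix x assume "x \<in> carrier M"
  with assms show "descends (tpow_rels H n) (tens_rels H n N) (\<lambda>a. case (a, x) of (a, x) \<Rightarrow> gen (a, g x))"
    by (auto simp: H_linear_def intro: descends_pair)
qed (use assms in \<open>auto simp: H_linear_def Pi_iff intro: eq_mod_tens_add eq_mod_tens_smult gen_finsupp\<close>)

section \<open>Substitution of a binary map into a binary map\<close>

definition plug_kernel :: "nat \<Rightarrow> 'h list \<Rightarrow> 'h list \<times> 'n \<Rightarrow> ('h list \<times> 'n \<Rightarrow>\<^sub>0 'k)" where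
  "plug_kernel m h = (\<lambda>(f, e). lin_ext (\<lambda>b. gen (b, e)) (coslot m h f))"

lemma coslot_keys_length:
  "length h = 2 \<Longrightarrow> m < 2 \<Longrightarrow> length f = 2 \<Longrightarrow> b \<in> Poly_Mapping.keys (coslot m h f) \<Longrightarrow> length b = 3"
  using coslot_finsupp[of h m 2 f] by (auto simp: finsupp_def)

text \<open>Balancing over \<open>H\<close> is where coassociativity enters: the coproduct in slot \<open>m\<close> applied to
  \<open>c\<^sub>(\<^sub>1\<^sub>) \<otimes> c\<^sub>(\<^sub>2\<^sub>)\<close> is the iterated coproduct of \<open>c\<close> for both values of \<open>m\<close>.\<close>

lemma tens_hom_plug_kernel:
  assumes h: "length h = 2" and m: "m < 2"
  shows "tens_hom H 2 N 3 N (plug_kernel m h)"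
  unfolding tens_hom_def
proof (intro conjI descends_tensI)
  have C: "descends (tpow_rels H 2) (tpow_rels H 3) (coslot m h)"
    using descends_coslot[OF h m] by (simp add: eval_nat_numeral)
  show "descends (tpow_rels H 2) (tens_rels H 3 N) (\<lambda>a. plug_kernel m h (a, x))" if "x \<in> carrier N" for x
    using descends_comp[OF C descends_pair[OF that]] by (simp add: plug_kernel_def)
  show "eq_mod (tens_rels H 3 N) (plug_kernel m h (a, x \<oplus>\<^bsub>N\<^esub> y)) (plug_kernel m h (a, x) + plug_kernel m h (a, y))"
    if "length a = 2" "x \<in> carrier N" "y \<in> carrier N" for a x y
    unfolding plug_kernel_def prod.case lin_ext_add_fun[symmetric]
    using that coslot_keys_length[OF h m] by (intro eq_mod_lin_ext eq_mod_tens_add) auto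
  show "\<forall>a x. length a = 2 \<longrightarrow> x \<in> carrier N \<longrightarrow> plug_kernel m h (a, x) \<in> tens_supp 3 N"
    using coslot_keys_length[OF h m] by (auto simp: plug_kernel_def intro!: lin_ext_finsupp gen_finsupp)
  fix a :: "'h list" and c x assume a: "length a = 2" and x: "x \<in> carrier N"
  let ?R = "tens_rels H 3 N"
  let ?F = "\<lambda>d. take m a @ map2 (*) h d @ drop (Suc m) a"
  let ?D = "rep (comult H (a ! m))" and ?C = "rep (comult H c)"
  let ?E = "\<lambda>d t. gen (map2 (*) (?F d) t, x)"
  have len: "length (?F d) = 3" if "d \<in> Poly_Mapping.keys ?D" for d
    using that a h m by (auto dest!: length_keys_comult)
  have E: "descends (tpow_rels H 3) ?R (?E d)" if "d \<in> Poly_Mapping.keys ?D" for d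
    using descends_comp[OF descends_slotwise_linear[OF slotwise_linear_lmult[OF len[OF that]]] descends_pair[OF x]]
    by simp
  have "eq_mod ?R (plug_kernel m h (a, c \<odot>\<^bsub>N\<^esub> x)) (lin_ext (\<lambda>d. lin_ext (?E d) (rep (iter_comult H 3 c))) ?D)"
    unfolding plug_kernel_def prod.case coslot_def lin_ext_lin_ext lin_ext_single free.scale_one
    by (intro eq_mod_lin_ext eq_mod_tens_smult len x)
  \<comment> \<open>The threefold coproduct of \<open>c\<close> is expanded by splitting the same
    slot \<open>m\<close> in which \<open>a\<close> was split, so that the factors of
    \<open>c\<close> line up with those of \<open>a\<close>.\<close>
  also have "eq_mod ?R \<dots> (lin_ext (\<lambda>d. lin_ext (?E d) (lin_ext (coslot m [1, 1]) ?C)) ?D)"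
  proof (intro eq_mod_lin_ext descends_eq_mod[OF E])
    have "iter_comult H 3 c = tpow_class H 3 (lin_ext (coslot m [1, 1]) ?C)"
      unfolding iter_comult_3[OF m] comult_at_eq_coslot by (simp add: eval_nat_numeral)
    then show "eq_mod (tpow_rels H 3) (rep (iter_comult H 3 c)) (lin_ext (coslot m [1, 1]) ?C)"
      by (simp add: eq_mod_rep_coset eq_mod_sym)
  qed
  \<comment> \<open>After the two sums are exchanged, the inner sum for each term \<open>b\<close>
    of the coproduct of \<open>c\<close> is the right side of \<open>coslot_mult\<close>.\<close>
  also have "lin_ext (\<lambda>d. lin_ext (?E d) (lin_ext (coslot m [1, 1]) ?C)) ?D
      = lin_ext (\<lambda>b. lin_ext (\<lambda>t. gen (t, x))
          (lin_ext (\<lambda>d. lin_ext (\<lambda>d'. gen (map2 (*) (?F d) d')) (coslot m [1, 1] b)) ?D)) ?C"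
    unfolding lin_ext_lin_ext lin_ext_single free.scale_one
    by (rule lin_ext_swap[where F = "\<lambda>d b. lin_ext (?E d) (coslot m [1, 1] b)"])
  also have "eq_mod ?R \<dots> (lin_ext (\<lambda>b. lin_ext (\<lambda>t. gen (t, x)) (coslot m h (map2 (*) a b))) ?C)"
  proof (rule eq_mod_lin_ext, rule descends_eq_mod[OF descends_pair[OF x]], rule eq_mod_sym)
    fix b assume "b \<in> Poly_Mapping.keys ?C"
    then have "length b = 2" by (rule length_keys_comult)
    have three: "Suc 2 = 3" by simp
    from coslot_mult[OF h m a \<open>length b = 2\<close>]
    show "eq_mod (tpow_rels H 3) (coslot m h (map2 (*) a b))
        (lin_ext (\<lambda>d. lin_ext (\<lambda>d'. gen (map2 (*) (?F d) d')) (coslot m [1, 1] b)) ?D)"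
      by (simp only: three)
  qed
  also have "\<dots> = lin_ext (\<lambda>d. plug_kernel m h (map2 (*) a d, x)) (rep (iter_comult H 2 c))"
    by (simp add: plug_kernel_def iter_comult_2)
  finally show "eq_mod ?R (plug_kernel m h (a, c \<odot>\<^bsub>N\<^esub> x))
      (lin_ext (\<lambda>d. plug_kernel m h (map2 (*) a d, x)) (rep (iter_comult H 2 c)))" .
qed

text \<open>A substitution involves two choices of representatives. Descent of
  \<open>plug_kernel\<close> handles the inner one, for \<open>G e\<close>; descent of this map in
  \<open>(h, e)\<close> handles the outer one.\<close>

definition plug_ker :: "nat \<Rightarrow> ('m \<Rightarrow> ('h list \<times> 'n \<Rightarrow>\<^sub>0 'k) set) \<Rightarrow> 'h list \<times> 'm \<Rightarrow> ('h list \<times> 'n \<Rightarrow>\<^sub>0 'k)" where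
  "plug_ker m G = (\<lambda>(h, e). lin_ext (plug_kernel m h) (rep (G e)))"

lemma plug_eq_induced: "plug H N 2 m 2 G = induced H 3 N (plug_ker m G)"
  by (rule ext) (simp add: plug_def induced_def plug_ker_def plug_kernel_def coslot_def iter_comult_2 lin_ext_lin_ext)

text \<open>What polylinearity leaves when the other argument is frozen: that argument is acted on
  by 1, so \<open>c\<close> multiplies only factor \<open>m\<close>.\<close>

definition slot_linear :: "nat \<Rightarrow> ('h, 'm) module \<Rightarrow> ('h, 'n) module \<Rightarrow> ('m \<Rightarrow> ('h list \<times> 'n \<Rightarrow>\<^sub>0 'k) set) \<Rightarrow> bool" where
  "slot_linear m M N G \<longleftrightarrow> (\<forall>x\<in>carrier M. G x \<in> tens H 2 N)
     \<and> (\<forall>x\<in>carrier M. \<forall>y\<in>carrier M. G (x \<oplus>\<^bsub>M\<^esub> y) = G x \<boxplus> G y)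
     \<and> (\<forall>c. \<forall>x\<in>carrier M. G (c \<odot>\<^bsub>M\<^esub> x) = tens_lmult H 2 N ([1, 1][m := c]) (G x))"

lemma slot_linear_closed: "slot_linear m M N G \<Longrightarrow> x \<in> carrier M \<Longrightarrow> G x \<in> tens H 2 N"
  by (simp add: slot_linear_def)

lemma eq_mod_rep_add:
  assumes "A \<in> tens H n M" "B \<in> tens H n M"
  shows "eq_mod (tens_rels H n M) (rep (A \<boxplus> B)) (rep A + rep B)"
  using assms tens_class_add_closed[OF assms]
  by (simp add: coset_eq_iff[symmetric] coset_add[symmetric])

lemma eq_mod_rep_diff:
  assumes "A \<in> tens H n M" "B \<in> tens H n M"
  shows "eq_mod (tens_rels H n M) (rep (A \<boxminus> B)) (rep A - rep B)"
  using assms tens_class_diff_closed[OF assms]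
  by (simp add: coset_eq_iff[symmetric] coset_diff[symmetric])

text \<open>Here the factors of the inserted element vary and \<open>f\<close> is fixed; they enter
  through right multiplication by the terms of a fixed coproduct.\<close>

lemma descends_coslot_left:
  assumes "length f = 2" "m < 2"
  shows "descends (tpow_rels H 2) (tpow_rels H 3) (\<lambda>h. coslot m h f)"
  unfolding coslot_def
proof (rule descends_lin_ext)
  fix d assume "d \<in> Poly_Mapping.keys (rep (comult H (f ! m)))"
  then have "length d = 2" by (rule length_keys_comult)
  from descends_slotwise_linear[OF slotwise_linear_insert[OF slotwise_linear_rmult[OF this] assms]]
  show "descends (tpow_rels H 2) (tpow_rels H 3) (\<lambda>h. gen (take m f @ map2 (*) h d @ drop (Suc m) f))"
    by simp
qed

text \<open>The coproduct of \<open>c * f ! m\<close> factors, and its left part is attached to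
  \<open>h\<close>. This moves a scalar from the substituted element to the factors of the list in
  front of it.\<close>

lemma coslot_lmult:
  assumes h: "length h = 2" and m: "m < 2" and f: "length f = 2"
  shows "eq_mod (tpow_rels H 3) (coslot m h (map2 (*) ([1, 1][m := c]) f))
    (lin_ext (\<lambda>d. coslot m (map2 (*) h d) f) (rep (comult H c)))"
proof -
  let ?K = "\<lambda>d. gen (take m f @ map2 (*) h d @ drop (Suc m) f)"
  have K: "descends (tpow_rels H 2) (tpow_rels H 3) ?K"
    using descends_insert[OF h f m] by (simp add: eval_nat_numeral)
  from f obtain p q where fpq: "f = [p, q]" by (auto simp: length_Suc_conv numeral_2_eq_2)
  from m have m01: "m = 0 \<or> m = 1" by linarith
  have "take m (map2 (*) ([1, 1][m := c]) f) = take m f" "drop (Suc m) (map2 (*) ([1, 1][m := c]) f) = drop (Suc m) f"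
    "map2 (*) ([1, 1][m := c]) f ! m = c * f ! m"
    using fpq m01 by auto
  then have "coslot m h (map2 (*) ([1, 1][m := c]) f) = lin_ext ?K (rep (comult H (c * f ! m)))"
    by (simp add: coslot_def)
  then show ?thesis
    using descends_eq_mod[OF K rep_comult_mult[of c "f ! m"]]
    by (simp add: coslot_def lin_ext_lin_ext map2_mult_assoc)
qed

text \<open>For balancing, \<open>c\<close> acting on the substituted element becomes a left
  multiplication of \<open>G x\<close> in slot \<open>m\<close> by slot linearity, and
  \<open>coslot_lmult\<close> turns this into right multiplication of \<open>h\<close> by the
  coproduct of \<open>c\<close>.\<close>

lemma tens_hom_plug:
  assumes N: "left_module N" and G: "slot_linear m M N G" and m: "m < 2"
  shows "tens_hom H 2 M 3 N (plug_ker m G)"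
  unfolding tens_hom_def
proof (intro conjI descends_tensI allI impI)
  let ?R = "tens_rels H 3 N"
  have closed: "G x \<in> tens H 2 N" if "x \<in> carrier M" for x
    using G that by (auto simp: slot_linear_def)
  have supp: "length f = 2" "e \<in> carrier N" if "(f, e) \<in> Poly_Mapping.keys (rep (G x))" "x \<in> carrier M" for f e x
    using rep_tens_supp[OF N closed[OF that(2)]] that(1) by (auto simp: finsupp_def)
  have K: "descends (tens_rels H 2 N) ?R (plug_kernel m h)" if "length h = 2" for h
    using tens_hom_plug_kernel[OF that m] by (auto simp: tens_hom_def)
  show "descends (tpow_rels H 2) ?R (\<lambda>h. plug_ker m G (h, x))" if x: "x \<in> carrier M" for x
    unfolding plug_ker_def prod.case
  proof (rule descends_lin_ext, safe)
    fix f e assume "(f, e) \<in> Poly_Mapping.keys (rep (G x))"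
    from supp[OF this x] show "descends (tpow_rels H 2) ?R (\<lambda>h. plug_kernel m h (f, e))"
      unfolding plug_kernel_def prod.case by (intro descends_comp[OF descends_coslot_left descends_pair] m)
  qed
  fix h :: "'h list" and x assume h: "length h = 2" and x: "x \<in> carrier M"
  show "eq_mod ?R (plug_ker m G (h, x \<oplus>\<^bsub>M\<^esub> y)) (plug_ker m G (h, x) + plug_ker m G (h, y))"
    if y: "y \<in> carrier M" for y
    using G x y descends_eq_mod[OF K[OF h] eq_mod_rep_add[OF closed[OF x] closed[OF y]]]
    by (simp add: plug_ker_def slot_linear_def lin_ext_add)
  show "plug_ker m G (h, x) \<in> tens_supp 3 N"
    unfolding plug_ker_def prod.case
    by (rule tens_hom_supp[OF tens_hom_plug_kernel[OF h m] rep_tens_supp[OF N closed[OF x]]])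
  show "eq_mod ?R (plug_ker m G (h, c \<odot>\<^bsub>M\<^esub> x))
      (lin_ext (\<lambda>d. plug_ker m G (map2 (*) h d, x)) (rep (iter_comult H 2 c)))" for c
  proof -
    let ?c = "[1, 1][m := c]"
    have "eq_mod (tens_rels H 2 N) (rep (G (c \<odot>\<^bsub>M\<^esub> x))) (lin_ext (\<lambda>(a, y). gen (map2 (*) ?c a, y)) (rep (G x)))"
      using G x by (simp add: slot_linear_def tens_lmult_def eq_mod_rep_coset eq_mod_sym)
    from descends_eq_mod[OF K[OF h] this]
    have "eq_mod ?R (plug_ker m G (h, c \<odot>\<^bsub>M\<^esub> x))
        (lin_ext (\<lambda>(f, e). plug_kernel m h (map2 (*) ?c f, e)) (rep (G x)))"
      by (simp add: plug_ker_def lin_ext_lin_ext case_prod_unfold)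
    also have "eq_mod ?R \<dots> (lin_ext (\<lambda>p. lin_ext (\<lambda>d. plug_kernel m (map2 (*) h d) p) (rep (comult H c))) (rep (G x)))"
    proof (rule eq_mod_lin_ext, safe)
      fix f e assume "(f, e) \<in> Poly_Mapping.keys (rep (G x))"
      note fe = supp[OF this x]
      from descends_eq_mod[OF descends_pair[OF fe(2)] coslot_lmult[OF h m fe(1)]]
      show "eq_mod ?R (plug_kernel m h (map2 (*) ?c f, e))
          (lin_ext (\<lambda>d. plug_kernel m (map2 (*) h d) (f, e)) (rep (comult H c)))"
        by (simp add: plug_kernel_def lin_ext_lin_ext)
    qed
    also have "\<dots> = lin_ext (\<lambda>d. plug_ker m G (map2 (*) h d, x)) (rep (iter_comult H 2 c))"
      unfolding plug_ker_def prod.case iter_comult_2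
      by (rule lin_ext_swap[where F = "\<lambda>p d. plug_kernel m (map2 (*) h d) p"])
    finally show ?thesis .
  qed
qed

section \<open>Composition calculus\<close>

lemma plug_closed:
  assumes "left_module N" "slot_linear m M N G" "m < 2" "A \<in> tens H 2 M"
  shows "plug H N 2 m 2 G A \<in> tens H 3 N"
  unfolding plug_eq_induced by (rule induced_closed[OF tens_hom_plug]) fact+

lemma plug_add:
  assumes "left_module N" "slot_linear m M N G" "m < 2" "A \<in> tens H 2 M" "B \<in> tens H 2 M"
  shows "plug H N 2 m 2 G (A \<boxplus> B) = plug H N 2 m 2 G A \<boxplus> plug H N 2 m 2 G B"
  unfolding plug_eq_induced by (rule induced_add[OF tens_hom_plug]) fact+

lemma plug_diff:
  assumes "left_module N" "slot_linear m M N G" "m < 2" "A \<in> tens H 2 M" "B \<in> tens H 2 M"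
  shows "plug H N 2 m 2 G (A \<boxminus> B) = plug H N 2 m 2 G A \<boxminus> plug H N 2 m 2 G B"
  unfolding plug_eq_induced by (rule induced_diff[OF tens_hom_plug]) fact+

lemma plug_zero:
  assumes "left_module N" "slot_linear m M N G" "m < 2"
  shows "plug H N 2 m 2 G (tens_class H 2 M 0) = tens_class H 3 N 0"
  unfolding plug_eq_induced by (rule induced_zero[OF tens_hom_plug]) fact+

lemma plug_cong:
  assumes "left_module M" "A \<in> tens H 2 M" "\<And>e. e \<in> carrier M \<Longrightarrow> G e = G' e"
  shows "plug H N 2 m 2 G A = plug H N 2 m 2 G' A"
  unfolding plug_eq_induced using assms by (intro induced_cong) (auto simp: plug_ker_def)

lemma descends_plug_kernel:
  "length h = 2 \<Longrightarrow> m < 2 \<Longrightarrow> descends (tens_rels H 2 N) (tens_rels H 3 N) (plug_kernel m h)"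
  using tens_hom_plug_kernel unfolding tens_hom_def by blast

text \<open>The representative chosen for \<open>G e \<boxplus> G' e\<close> is unrelated to those
  of the summands; descent of \<open>plug_kernel\<close> absorbs the difference.\<close>

lemma plug_add_fun:
  assumes "left_module M" "m < 2" "A \<in> tens H 2 M"
    and "\<And>e. e \<in> carrier M \<Longrightarrow> G e \<in> tens H 2 N" "\<And>e. e \<in> carrier M \<Longrightarrow> G' e \<in> tens H 2 N"
  shows "plug H N 2 m 2 (\<lambda>e. G e \<boxplus> G' e) A = plug H N 2 m 2 G A \<boxplus> plug H N 2 m 2 G' A"
proof -
  have "plug H N 2 m 2 (\<lambda>e. G e \<boxplus> G' e) A = induced H 3 N (\<lambda>p. plug_ker m G p + plug_ker m G' p) A"
    unfolding plug_eq_induced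
  proof (rule induced_cong[OF assms(1,3)])
    fix h :: "'h list" and e assume h: "length h = 2" and e: "e \<in> carrier M"
    show "eq_mod (tens_rels H 3 N) (plug_ker m (\<lambda>e. G e \<boxplus> G' e) (h, e)) (plug_ker m G (h, e) + plug_ker m G' (h, e))"
      using descends_eq_mod[OF descends_plug_kernel[OF h assms(2)] eq_mod_rep_add[OF assms(4,5)[OF e]]]
      by (simp add: plug_ker_def lin_ext_add)
  qed
  then show ?thesis by (simp add: plug_eq_induced induced_def lin_ext_add_fun coset_add)
qed

lemma plug_diff_fun:
  assumes "left_module M" "m < 2" "A \<in> tens H 2 M"
    and "\<And>e. e \<in> carrier M \<Longrightarrow> G e \<in> tens H 2 N" "\<And>e. e \<in> carrier M \<Longrightarrow> G' e \<in> tens H 2 N"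
  shows "plug H N 2 m 2 (\<lambda>e. G e \<boxminus> G' e) A = plug H N 2 m 2 G A \<boxminus> plug H N 2 m 2 G' A"
proof -
  have "plug H N 2 m 2 (\<lambda>e. G e \<boxminus> G' e) A = induced H 3 N (\<lambda>p. plug_ker m G p - plug_ker m G' p) A"
    unfolding plug_eq_induced
  proof (rule induced_cong[OF assms(1,3)])
    fix h :: "'h list" and e assume h: "length h = 2" and e: "e \<in> carrier M"
    show "eq_mod (tens_rels H 3 N) (plug_ker m (\<lambda>e. G e \<boxminus> G' e) (h, e)) (plug_ker m G (h, e) - plug_ker m G' (h, e))"
      using descends_eq_mod[OF descends_plug_kernel[OF h assms(2)] eq_mod_rep_diff[OF assms(4,5)[OF e]]]
      by (simp add: plug_ker_def lin_ext_diff)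
  qed
  then show ?thesis by (simp add: plug_eq_induced induced_def lin_ext_diff_fun coset_diff)
qed

lemma plug_zero_fun:
  assumes "left_module M" "m < 2" "A \<in> tens H 2 M"
  shows "plug H N 2 m 2 (\<lambda>e. tens_class H 2 N 0) A = tens_class H 3 N 0"
proof -
  have "plug H N 2 m 2 (\<lambda>e. tens_class H 2 N 0) A = induced H 3 N (\<lambda>p. 0) A"
    unfolding plug_eq_induced
    using assms(2) lin_ext_rep_coset[OF descends_plug_kernel, where p = 0]
    by (intro induced_cong[OF assms(1,3)]) (simp add: plug_ker_def)
  then show ?thesis by (simp add: induced_def)
qed

section \<open>Functoriality in the module\<close>

lemma tens_map_eq_induced: "tens_map H n N g = induced H n N (\<lambda>(a, x). gen (a, g x))"
  by (rule ext) (simp add: tens_map_def induced_def)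

lemma tens_lmult_eq_induced: "tens_lmult H n M c = induced H n M (\<lambda>(a, x). gen (map2 (*) c a, x))"
  by (rule ext) (simp add: tens_lmult_def induced_def)

lemma plug_tens_map:
  assumes "left_module M" "left_module N" "slot_linear m M' N G" "m < 2" "H_linear M M' g" "A \<in> tens H 2 M"
  shows "plug H N 2 m 2 G (tens_map H 2 M' g A) = plug H N 2 m 2 (\<lambda>e. G (g e)) A"
  unfolding plug_eq_induced tens_map_eq_induced induced_induced[OF tens_hom_plug[OF assms(2-4)]]
  by (rule induced_cong[OF assms(1,6)]) (simp add: plug_ker_def)

text \<open>On generators \<open>g\<close> changes only the module element and
  \<open>plug_kernel\<close> only the factors in \<open>H\<close>, so they commute.\<close>

lemma tens_map_plug:
  assumes "left_module M" "left_module N" "m < 2" "H_linear N N' g" "A \<in> tens H 2 M"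
    and "\<And>e. e \<in> carrier M \<Longrightarrow> G e \<in> tens H 2 N"
  shows "tens_map H 3 N' g (plug H N 2 m 2 G A) = plug H N' 2 m 2 (\<lambda>e. tens_map H 2 N' g (G e)) A"
  unfolding plug_eq_induced tens_map_eq_induced induced_induced[OF tens_hom_map[OF assms(4)]]
proof (rule induced_cong[OF assms(1,5)])
  fix h :: "'h list" and e assume h: "length h = 2" and e: "e \<in> carrier M"
  have "lin_ext (\<lambda>(a, x). gen (a, g x)) (plug_ker m G (h, e))
      = lin_ext (plug_kernel m h) (lin_ext (\<lambda>(a, x). gen (a, g x)) (rep (G e)))"
    by (simp add: plug_ker_def plug_kernel_def lin_ext_lin_ext case_prod_unfold)
  also have "eq_mod (tens_rels H 3 N') \<dots> (plug_ker m (\<lambda>e. induced H 2 N' (\<lambda>(a, x). gen (a, g x)) (G e)) (h, e))"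
    unfolding plug_ker_def prod.case induced_def
    by (rule eq_mod_sym[OF lin_ext_rep_coset[OF descends_plug_kernel[OF h assms(3)]]])
  finally show "eq_mod (tens_rels H 3 N') (lin_ext (\<lambda>(a, x). gen (a, g x)) (plug_ker m G (h, e)))
      (plug_ker m (\<lambda>e. induced H 2 N' (\<lambda>(a, x). gen (a, g x)) (G e)) (h, e))" .
qed

lemma tens_map_closed:
  "H_linear M N g \<Longrightarrow> A \<in> tens H n M \<Longrightarrow> tens_map H n N g A \<in> tens H n N"
  unfolding tens_map_eq_induced by (rule induced_closed[OF tens_hom_map])

lemma tens_map_add:
  "H_linear M N g \<Longrightarrow> A \<in> tens H n M \<Longrightarrow> B \<in> tens H n M \<Longrightarrow>
    tens_map H n N g (A \<boxplus> B) = tens_map H n N g A \<boxplus> tens_map H n N g B"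
  unfolding tens_map_eq_induced by (rule induced_add[OF tens_hom_map])

lemma tens_map_diff:
  "H_linear M N g \<Longrightarrow> A \<in> tens H n M \<Longrightarrow> B \<in> tens H n M \<Longrightarrow>
    tens_map H n N g (A \<boxminus> B) = tens_map H n N g A \<boxminus> tens_map H n N g B"
  unfolding tens_map_eq_induced by (rule induced_diff[OF tens_hom_map])

lemma tens_map_neg:
  "H_linear M N g \<Longrightarrow> A \<in> tens H n M \<Longrightarrow> tens_map H n N g (cneg A) = cneg (tens_map H n N g A)"
  unfolding tens_map_eq_induced by (rule induced_neg[OF tens_hom_map])

lemma tens_map_zero:
  "H_linear M N g \<Longrightarrow> tens_map H n N g (tens_class H n M 0) = tens_class H n N 0"
  unfolding tens_map_eq_induced by (rule induced_zero[OF tens_hom_map])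

lemma tens_map_comp:
  assumes "left_module M" "H_linear N K g" "A \<in> tens H n M" "\<And>x. x \<in> carrier M \<Longrightarrow> g (f x) = k x"
  shows "tens_map H n K g (tens_map H n N f A) = tens_map H n K k A"
  unfolding tens_map_eq_induced induced_induced[OF tens_hom_map[OF assms(2)]]
  by (rule induced_cong[OF assms(1,3)]) (simp add: assms(4))

lemma tens_map_id:
  assumes "left_module M" "A \<in> tens H n M" "\<And>x. x \<in> carrier M \<Longrightarrow> g x = x"
  shows "tens_map H n M g A = A"
  unfolding tens_map_eq_induced using assms by (intro induced_id) auto

section \<open>The slot convention as an exchange of factors\<close>

definition swapped :: "nat \<Rightarrow> ('h, 'm) module \<Rightarrow> ('h list \<times> 'm \<Rightarrow>\<^sub>0 'k) set \<Rightarrow> ('h list \<times> 'm \<Rightarrow>\<^sub>0 'k) set" where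
  "swapped n M = induced H n M (\<lambda>(a, x). gen (swap01 a, x))"

lemma arrange_eq_swapped:
  assumes M: "left_module M" and A: "A \<in> tens H (length ps) M"
    and ps: "\<And>a :: 'h list. length a = length ps \<Longrightarrow> map snd (sort_key fst (zip ps a)) = swap01 a"
  shows "arrange H M ps A = swapped (length ps) M A"
  unfolding arrange_def swapped_def induced_def
  using rep_tens_supp[OF M A] ps
  by (intro arg_cong[of _ _ "tens_class H (length ps) M"] lin_ext_cong) (auto simp: finsupp_def)

lemma arrange_10:
  assumes "left_module M" "A \<in> tens H 2 M"
  shows "arrange H M [1, 0] A = swapped 2 M A"
proof -
  have "map snd (sort_key fst (zip [1, 0 :: nat] a)) = swap01 a" if "length a = 2" for a :: "'h list"
    using that by (auto simp: length_Suc_conv numeral_2_eq_2 swap01_def)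
  then show ?thesis
    using arrange_eq_swapped[of M A "[1, 0]"] assms by (simp add: numeral_2_eq_2)
qed

lemma arrange_102:
  assumes "left_module M" "A \<in> tens H 3 M"
  shows "arrange H M [1, 0, 2] A = swapped 3 M A"
proof -
  have "map snd (sort_key fst (zip [1, 0, 2 :: nat] a)) = swap01 a" if "length a = 3" for a :: "'h list"
    using that by (auto simp: length_Suc_conv numeral_3_eq_3 swap01_def)
  then show ?thesis
    using arrange_eq_swapped[of M A "[1, 0, 2]"] assms by (simp add: numeral_3_eq_3)
qed

lemma swapped_closed: "2 \<le> n \<Longrightarrow> A \<in> tens H n M \<Longrightarrow> swapped n M A \<in> tens H n M"
  unfolding swapped_def by (rule induced_closed[OF tens_hom_swap01])

lemma swapped_add:
  "2 \<le> n \<Longrightarrow> A \<in> tens H n M \<Longrightarrow> B \<in> tens H n M \<Longrightarrow> swapped n M (A \<boxplus> B) = swapped n M A \<boxplus> swapped n M B"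
  unfolding swapped_def by (rule induced_add[OF tens_hom_swap01])

lemma swapped_diff:
  "2 \<le> n \<Longrightarrow> A \<in> tens H n M \<Longrightarrow> B \<in> tens H n M \<Longrightarrow> swapped n M (A \<boxminus> B) = swapped n M A \<boxminus> swapped n M B"
  unfolding swapped_def by (rule induced_diff[OF tens_hom_swap01])

lemma swapped_neg:
  "2 \<le> n \<Longrightarrow> A \<in> tens H n M \<Longrightarrow> swapped n M (cneg A) = cneg (swapped n M A)"
  unfolding swapped_def by (rule induced_neg[OF tens_hom_swap01])

lemma swapped_zero: "2 \<le> n \<Longrightarrow> swapped n M (tens_class H n M 0) = tens_class H n M 0"
  unfolding swapped_def by (rule induced_zero[OF tens_hom_swap01])

lemma swapped_swapped:
  assumes "left_module M" "2 \<le> n" "A \<in> tens H n M"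
  shows "swapped n M (swapped n M A) = A"
  unfolding swapped_def induced_induced[OF tens_hom_swap01[OF assms(2)]]
  using assms by (intro induced_id) (auto simp: swap01_swap01)

lemma swapped_tens_map:
  assumes "left_module M" "H_linear M N g" "2 \<le> n" "A \<in> tens H n M"
  shows "swapped n N (tens_map H n N g A) = tens_map H n N g (swapped n M A)"
  unfolding swapped_def tens_map_eq_induced
    induced_induced[OF tens_hom_swap01[OF assms(3)]] induced_induced[OF tens_hom_map[OF assms(2)]]
  by (rule induced_cong[OF assms(1,4)]) simp

lemma tens_lmult_add:
  "length c = n \<Longrightarrow> A \<in> tens H n M \<Longrightarrow> B \<in> tens H n M \<Longrightarrow>
    tens_lmult H n M c (A \<boxplus> B) = tens_lmult H n M c A \<boxplus> tens_lmult H n M c B"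
  unfolding tens_lmult_eq_induced by (rule induced_add[OF tens_hom_lmult])

lemma tens_lmult_zero:
  "length c = n \<Longrightarrow> tens_lmult H n M c (tens_class H n M 0) = tens_class H n M 0"
  unfolding tens_lmult_eq_induced by (rule induced_zero[OF tens_hom_lmult])

lemma tens_lmult_tens_map:
  assumes "left_module M" "H_linear M N g" "length c = n" "A \<in> tens H n M"
  shows "tens_lmult H n N c (tens_map H n N g A) = tens_map H n N g (tens_lmult H n M c A)"
  unfolding tens_lmult_eq_induced tens_map_eq_induced
    induced_induced[OF tens_hom_lmult[OF assms(3)]] induced_induced[OF tens_hom_map[OF assms(2)]]
  by (rule induced_cong[OF assms(1,4)]) simp

lemma polylinear2_slot0:
  assumes "polylinear2 H M1 M2 N \<phi>" "left_module M2" "y \<in> carrier M2"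
  shows "slot_linear 0 M1 N (\<lambda>e. \<phi> e y)"
proof -
  have "\<phi> (c \<odot>\<^bsub>M1\<^esub> x) y = tens_lmult H 2 N [c, 1] (\<phi> x y)" if "x \<in> carrier M1" for c x
  proof -
    have "\<phi> (c \<odot>\<^bsub>M1\<^esub> x) (1 \<odot>\<^bsub>M2\<^esub> y) = tens_lmult H 2 N [c, 1] (\<phi> x y)"
      using assms(1,3) that unfolding polylinear2_def by blast
    then show ?thesis by (simp add: left_module.smult_one[OF assms(2,3)])
  qed
  then show ?thesis using assms(1,3) unfolding slot_linear_def polylinear2_def by auto
qed

lemma polylinear2_slot1:
  assumes "polylinear2 H M1 M2 N \<phi>" "left_module M1" "x \<in> carrier M1"
  shows "slot_linear 1 M2 N (\<lambda>e. \<phi> x e)"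
proof -
  have "\<phi> x (c \<odot>\<^bsub>M2\<^esub> y) = tens_lmult H 2 N [1, c] (\<phi> x y)" if "y \<in> carrier M2" for c y
  proof -
    have "\<phi> (1 \<odot>\<^bsub>M1\<^esub> x) (c \<odot>\<^bsub>M2\<^esub> y) = tens_lmult H 2 N [1, c] (\<phi> x y)"
      using assms(1,3) that unfolding polylinear2_def by blast
    then show ?thesis by (simp add: left_module.smult_one[OF assms(2,3)])
  qed
  then show ?thesis using assms(1,3) unfolding slot_linear_def polylinear2_def by auto
qed

text \<open>The terms of the last morphism identity of a composite come in three such pairs; the part
  \<open>plug K (tens_map f V)\<close>, present in both summands with opposite signs, cancels.\<close>

lemma plug_pair:
  assumes modules: "left_module M" "left_module M'" "left_module N" "left_module N'" and m: "m < 2"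
    and g: "H_linear N N' g" and b: "H_linear N M' b" and f: "H_linear M M' f"
    and B': "slot_linear m N N B'" and B'': "slot_linear m N' N' B''"
    and K: "slot_linear m M' N' K" and \<Phi>: "slot_linear m M N \<Phi>"
    and rel: "\<And>u. u \<in> carrier N \<Longrightarrow> tens_map H 2 N' g (B' u) \<boxminus> B'' (g u) = K (b u)"
    and W2: "W2 \<in> tens H 2 N'" and W: "W \<in> tens H 2 N" and V: "V \<in> tens H 2 M" and V': "V' \<in> tens H 2 M'"
    and VV': "tens_map H 2 M' f V \<boxminus> V' = tens_map H 2 M' b W"
  shows "plug H N' 2 m 2 B'' (W2 \<boxplus> tens_map H 2 N' g W)
      \<boxplus> plug H N' 2 m 2 (\<lambda>e. K (f e) \<boxplus> tens_map H 2 N' g (\<Phi> e)) V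
    = (plug H N' 2 m 2 B'' W2 \<boxplus> plug H N' 2 m 2 K V')
      \<boxplus> tens_map H 3 N' g (plug H N 2 m 2 B' W \<boxplus> plug H N 2 m 2 \<Phi> V)"
proof -
  have closed: "u \<in> carrier N \<Longrightarrow> B' u \<in> tens H 2 N" "v \<in> carrier N' \<Longrightarrow> B'' v \<in> tens H 2 N'"
    "x \<in> carrier M' \<Longrightarrow> K x \<in> tens H 2 N'" "y \<in> carrier M \<Longrightarrow> \<Phi> y \<in> tens H 2 N" for u v x y
    by (simp_all add: slot_linear_closed[OF B'] slot_linear_closed[OF B''] slot_linear_closed[OF K]
      slot_linear_closed[OF \<Phi>])
  have maps: "u \<in> carrier N \<Longrightarrow> g u \<in> carrier N'" "u \<in> carrier N \<Longrightarrow> b u \<in> carrier M'"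
    "y \<in> carrier M \<Longrightarrow> f y \<in> carrier M'" for u y
    using g b f unfolding H_linear_def by auto
  let ?fV = "plug H N' 2 m 2 K (tens_map H 2 M' f V)"
  let ?r = "tens_map H 3 N' g (plug H N 2 m 2 B' W)"
  let ?s = "tens_map H 3 N' g (plug H N 2 m 2 \<Phi> V)"
  let ?p = "plug H N' 2 m 2 B'' W2" and ?q = "plug H N' 2 m 2 K V'"
  have terms: "?fV \<in> tens H 3 N'" "?r \<in> tens H 3 N'" "?s \<in> tens H 3 N'" "?p \<in> tens H 3 N'" "?q \<in> tens H 3 N'"
    using modules m g f B' B'' K \<Phi> W2 W V V' by (auto intro!: plug_closed tens_map_closed)
  \<comment> \<open>The relation between \<open>g\<close> and the two brackets is solved for the
    outer bracket.\<close>
  have B''_eq: "B'' (g u) = tens_map H 2 N' g (B' u) \<boxminus> K (b u)" if "u \<in> carrier N" for u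
  proof -
    have "tens_map H 2 N' g (B' u) \<in> tens H 2 N'" "B'' (g u) \<in> tens H 2 N'"
      using closed maps that g by (auto intro: tens_map_closed)
    then show ?thesis
      unfolding rel[OF that, symmetric] by (auto elim!: tensE simp: coset_diff)
  qed
  have "plug H N' 2 m 2 B'' (tens_map H 2 N' g W)
      = plug H N' 2 m 2 (\<lambda>u. tens_map H 2 N' g (B' u) \<boxminus> K (b u)) W"
    unfolding plug_tens_map[OF modules(3,4) B'' m g W]
    by (rule plug_cong[OF modules(3) W B''_eq])
  also have "\<dots> = ?r \<boxminus> plug H N' 2 m 2 (\<lambda>u. K (b u)) W"
    using closed maps g
    by (subst plug_diff_fun[OF modules(3) m W])
      (auto intro: tens_map_closed simp: tens_map_plug[OF modules(3,3) m g W])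
  \<comment> \<open>Substituting \<open>b u\<close> for \<open>u\<close> in \<open>W\<close> amounts
    to applying \<open>b\<close> to \<open>W\<close>, and \<open>VV'\<close> expresses the result as
    a difference.\<close>
  also have "plug H N' 2 m 2 (\<lambda>u. K (b u)) W = ?fV \<boxminus> ?q"
    unfolding plug_tens_map[OF modules(3,4) K m b W, symmetric] VV'[symmetric]
    by (rule plug_diff[OF modules(4) K m tens_map_closed[OF f V] V'])
  finally have 1: "plug H N' 2 m 2 B'' (tens_map H 2 N' g W) = ?r \<boxminus> (?fV \<boxminus> ?q)" .
  have 2: "plug H N' 2 m 2 (\<lambda>e. K (f e) \<boxplus> tens_map H 2 N' g (\<Phi> e)) V = ?fV \<boxplus> ?s"
    using closed maps g
    by (subst plug_add_fun[OF modules(1) m V])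
      (auto intro: tens_map_closed
        simp: tens_map_plug[OF modules(1,3) m g V] plug_tens_map[OF modules(1,4) K m f V])
  have 3: "tens_map H 3 N' g (plug H N 2 m 2 B' W \<boxplus> plug H N 2 m 2 \<Phi> V) = ?r \<boxplus> ?s"
    by (rule tens_map_add[OF g]) (use modules m B' \<Phi> W V in \<open>auto intro: plug_closed\<close>)
  show ?thesis
    unfolding plug_add[OF modules(4) B'' m W2 tens_map_closed[OF g W]] 1 2 3
    using terms by (auto elim!: tensE simp: coset_add coset_diff algebra_simps)
qed

section \<open>Constructions with polylinear and skew-symmetric maps\<close>

lemma polylinear2_closed: "polylinear2 H M1 M2 N \<phi> \<Longrightarrow> x \<in> carrier M1 \<Longrightarrow> y \<in> carrier M2 \<Longrightarrow> \<phi> x y \<in> tens H 2 N"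
  by (simp add: polylinear2_def)

lemma polylinear2_pullback:
  "polylinear2 H M' M' N \<phi> \<Longrightarrow> H_linear M M' f \<Longrightarrow> polylinear2 H M M N (\<lambda>x y. \<phi> (f x) (f y))"
  by (simp add: polylinear2_def H_linear_def Pi_iff)

lemma polylinear2_tens_map:
  "polylinear2 H M1 M2 N \<phi> \<Longrightarrow> left_module N \<Longrightarrow> H_linear N N' g \<Longrightarrow>
    polylinear2 H M1 M2 N' (\<lambda>x y. tens_map H 2 N' g (\<phi> x y))"
  by (simp add: polylinear2_def tens_map_closed tens_map_add tens_lmult_tens_map)

lemma polylinear2_add:
  "polylinear2 H M1 M2 N \<phi> \<Longrightarrow> polylinear2 H M1 M2 N \<psi> \<Longrightarrow> polylinear2 H M1 M2 N (\<lambda>x y. \<phi> x y \<boxplus> \<psi> x y)"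
  by (simp add: polylinear2_def tens_class_add_closed tens_lmult_add cplus_ac)

lemma polylinear2_zero: "polylinear2 H M1 M2 N (\<lambda>x y. tens_class H 2 N 0)"
  by (simp add: polylinear2_def zero_tens cplus_zero[OF zero_tens] tens_lmult_zero)

lemma polylinear2_restrict:
  assumes "left_module M1" "left_module M2" "polylinear2 H M1 M2 N \<phi>"
  shows "polylinear2 H M1 M2 N (\<lambda>x\<in>carrier M1. \<lambda>y\<in>carrier M2. \<phi> x y)"
proof -
  interpret M1: abelian_group M1 by (rule left_module.abelian_group[OF assms(1)])
  interpret M2: abelian_group M2 by (rule left_module.abelian_group[OF assms(2)])
  show ?thesis
    using assms(3) left_module.smult_closed[OF assms(1)] left_module.smult_closed[OF assms(2)]
    by (simp add: polylinear2_def)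
qed

lemma skew2_pullback:
  "skew2 H M' N \<phi> \<Longrightarrow> H_linear M M' f \<Longrightarrow> skew2 H M N (\<lambda>x y. \<phi> (f x) (f y))"
  by (simp add: skew2_def H_linear_def Pi_iff)

lemma skew2_iff_swapped:
  assumes "polylinear2 H M M N \<phi>" "left_module N"
  shows "skew2 H M N \<phi> \<longleftrightarrow> (\<forall>x\<in>carrier M. \<forall>y\<in>carrier M. swapped 2 N (\<phi> y x) = cneg (\<phi> x y))"
  by (simp add: skew2_def arrange_10[OF assms(2)] polylinear2_closed[OF assms(1)] del: One_nat_def)

lemma skew2_tens_map:
  assumes "polylinear2 H M M N \<phi>" "skew2 H M N \<phi>" "left_module N" "left_module N'" "H_linear N N' g"
  shows "skew2 H M N' (\<lambda>x y. tens_map H 2 N' g (\<phi> x y))"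
  using assms(2) polylinear2_closed[OF assms(1)]
  by (simp add: skew2_iff_swapped[OF assms(1,3)] skew2_iff_swapped[OF polylinear2_tens_map[OF assms(1,3,5)] assms(4)]
      swapped_tens_map[OF assms(3,5)] tens_map_neg[OF assms(5)])

lemma skew2_add:
  assumes "polylinear2 H M M N \<phi>" "skew2 H M N \<phi>" "polylinear2 H M M N \<psi>" "skew2 H M N \<psi>" "left_module N"
  shows "skew2 H M N (\<lambda>x y. \<phi> x y \<boxplus> \<psi> x y)"
  using assms(2,4) polylinear2_closed[OF assms(1)] polylinear2_closed[OF assms(3)]
  by (simp add: skew2_iff_swapped[OF assms(1,5)] skew2_iff_swapped[OF assms(3,5)]
      skew2_iff_swapped[OF polylinear2_add[OF assms(1,3)] assms(5)] swapped_add cneg_add[of _ H 2 N])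

lemma skew2_zero: "left_module N \<Longrightarrow> skew2 H M N (\<lambda>x y. tens_class H 2 N 0)"
  by (simp add: skew2_iff_swapped[OF polylinear2_zero] swapped_zero coset_neg)

lemma skew2_restrict: "skew2 H M N \<phi> \<Longrightarrow> skew2 H M N (\<lambda>x\<in>carrier M. \<lambda>y\<in>carrier M. \<phi> x y)"
  by (simp add: skew2_def)

section \<open>The category\<close>

text \<open>Exchanging the arguments turns the degree (0,1) identity into this one: both brackets
  and \<open>mor2 f\<close> change sign, the latter by its skew-symmetry.\<close>

lemma mor_beta2_10:
  assumes X: "two_term_Linf_pseudoalgebra H X" and Y: "two_term_Linf_pseudoalgebra H Y"
    and f: "two_term_morphism H X Y f" and u: "u \<in> carrier (L1 X)" and x: "x \<in> carrier (L0 X)"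
  shows "tens_map H 2 (L1 Y) (mor1 f) (beta2_10 X u x) \<boxminus> beta2_10 Y (mor1 f u) (mor0 f x)
    = mor2 f (beta1 X u) x"
proof -
  interpret X: two_term_Linf_pseudoalgebra H X by fact
  interpret Y: two_term_Linf_pseudoalgebra H Y by fact
  interpret f: two_term_morphism H X Y f by fact
  have fx: "mor0 f x \<in> carrier (L0 Y)" and fu: "mor1 f u \<in> carrier (L1 Y)" and bu: "beta1 X u \<in> carrier (L0 X)"
    using f.mor0_linear f.mor1_linear X.beta1_linear x u by (auto simp: H_linear_def)
  \<comment> \<open>The exchange is an involution on \<open>tens\<close>, so the mixed skew-symmetry
    axiom can be solved for \<open>beta2_10\<close>.\<close>
  have X10: "beta2_10 X u x = cneg (swapped 2 (L1 X) (beta2_01 X x u))"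
    using swapped_swapped[OF X.module1 _ polylinear2_closed[OF X.beta2_10_polylinear u x]]
      X.beta2_skew_mixed[OF x u] polylinear2_closed[OF X.beta2_10_polylinear u x]
      polylinear2_closed[OF X.beta2_01_polylinear x u]
    by (simp add: arrange_10[OF X.module1] swapped_neg del: One_nat_def)
  have Y10: "beta2_10 Y (mor1 f u) (mor0 f x) = cneg (swapped 2 (L1 Y) (beta2_01 Y (mor0 f x) (mor1 f u)))"
    using swapped_swapped[OF Y.module1 _ polylinear2_closed[OF Y.beta2_10_polylinear fu fx]]
      Y.beta2_skew_mixed[OF fx fu] polylinear2_closed[OF Y.beta2_10_polylinear fu fx]
      polylinear2_closed[OF Y.beta2_01_polylinear fx fu]
    by (simp add: arrange_10[OF Y.module1] swapped_neg del: One_nat_def)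
  have f2: "mor2 f (beta1 X u) x = cneg (swapped 2 (L1 Y) (mor2 f x (beta1 X u)))"
    using f.mor2_skew x bu by (simp add: skew2_iff_swapped[OF f.mor2_polylinear Y.module1] cneg_cneg)
  note tX = polylinear2_closed[OF X.beta2_01_polylinear x u]
  note tY = polylinear2_closed[OF Y.beta2_01_polylinear fx fu]
  have "tens_map H 2 (L1 Y) (mor1 f) (beta2_10 X u x)
      = cneg (swapped 2 (L1 Y) (tens_map H 2 (L1 Y) (mor1 f) (beta2_01 X x u)))"
    unfolding X10 by (simp add: tens_map_neg[OF f.mor1_linear] swapped_closed tX
        swapped_tens_map[OF X.module1 f.mor1_linear])
  then show ?thesis
    unfolding Y10 f2 f.mor_beta2_01[OF x u, symmetric]
      swapped_diff[OF order_refl tens_map_closed[OF f.mor1_linear tX] tY]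
    using swapped_closed[OF order_refl tens_map_closed[OF f.mor1_linear tX]] swapped_closed[OF order_refl tY]
    by (auto elim!: tensE simp: coset_neg coset_diff)
qed

text \<open>The left side of the identity for \<open>\<beta>\<^sub>3\<close> has this shape twice.
  The third entry keeps its own order of arguments, the exchange being built in, so that it can be
  an instance of the second with \<open>x\<close> and \<open>y\<close> interchanged.\<close>

definition alternating_sum :: "('h, 'm) module \<Rightarrow> ('h list \<times> 'm \<Rightarrow>\<^sub>0 'k) set \<Rightarrow> ('h list \<times> 'm \<Rightarrow>\<^sub>0 'k) set
    \<Rightarrow> ('h list \<times> 'm \<Rightarrow>\<^sub>0 'k) set \<Rightarrow> ('h list \<times> 'm \<Rightarrow>\<^sub>0 'k) set" where
  "alternating_sum M A B C = A \<boxminus> B \<boxplus> swapped 3 M C"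

lemma alternating_sum_add:
  assumes "A \<in> tens H 3 M" "B \<in> tens H 3 M" "C \<in> tens H 3 M" "A' \<in> tens H 3 M" "B' \<in> tens H 3 M" "C' \<in> tens H 3 M"
  shows "alternating_sum M (A \<boxplus> A') (B \<boxplus> B') (C \<boxplus> C') = alternating_sum M A B C \<boxplus> alternating_sum M A' B' C'"
proof -
  have "swapped 3 M C \<in> tens H 3 M" "swapped 3 M C' \<in> tens H 3 M"
    using assms by (auto intro: swapped_closed)
  then show ?thesis
    using assms(1,2,4,5) unfolding alternating_sum_def swapped_add[OF _ assms(3,6), simplified]
    by (auto elim!: tensE simp: coset_add coset_diff algebra_simps)
qed

lemma tens_map_alternating_sum:
  assumes "left_module M" "H_linear M N g" "A \<in> tens H 3 M" "B \<in> tens H 3 M" "C \<in> tens H 3 M"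
  shows "tens_map H 3 N g (alternating_sum M A B C)
    = alternating_sum N (tens_map H 3 N g A) (tens_map H 3 N g B) (tens_map H 3 N g C)"
  using assms
  by (simp add: alternating_sum_def tens_map_add[OF assms(2)] tens_map_diff[OF assms(2)] swapped_closed
      tens_class_diff_closed swapped_tens_map)

lemma six_terms_eq_alternating_sum:
  assumes "left_module M" "A \<in> tens H 3 M" "B \<in> tens H 3 M" "C \<in> tens H 3 M"
    "A' \<in> tens H 3 M" "B' \<in> tens H 3 M" "C' \<in> tens H 3 M"
  shows "A \<boxminus> B \<boxplus> arrange H M [1, 0, 2] C \<boxplus> A' \<boxminus> B' \<boxplus> arrange H M [1, 0, 2] C'
    = alternating_sum M (A \<boxplus> A') (B \<boxplus> B') (C \<boxplus> C')"
proof -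
  have "swapped 3 M C \<in> tens H 3 M" "swapped 3 M C' \<in> tens H 3 M"
    using assms by (auto intro: swapped_closed)
  then show ?thesis
    using assms(2,3,5,6)
    unfolding alternating_sum_add[OF assms(2-)] unfolding alternating_sum_def arrange_102[OF assms(1,4)] arrange_102[OF assms(1,7)]
    by (auto elim!: tensE simp: coset_add coset_diff algebra_simps)
qed

lemma telescope:
  assumes "A \<in> tens H n M" "B \<in> tens H n M" "C \<in> tens H n M"
  shows "(B \<boxminus> C) \<boxplus> (A \<boxminus> B) = A \<boxminus> C"
  using assms by (auto elim!: tensE simp: coset_add coset_diff)

text \<open>The two terms of the \<open>\<beta>\<^sub>3\<close> identity that substitute into slot
  0. They are kept together because composition produces a cancelling term in each of them.\<close>

definition pair0 :: "('k, 'h, 'a, 'b) two_term \<Rightarrow> ('k, 'h, 'a, 'b) two_term \<Rightarrow> ('k, 'h, 'a, 'b) mor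
    \<Rightarrow> 'a \<Rightarrow> 'a \<Rightarrow> 'a \<Rightarrow> ('h list \<times> 'b \<Rightarrow>\<^sub>0 'k) set" where
  "pair0 X Y f x y z = plug H (L1 Y) 2 0 2 (\<lambda>e. beta2_10 Y e (mor0 f z)) (mor2 f x y)
     \<boxplus> plug H (L1 Y) 2 0 2 (\<lambda>e. mor2 f e z) (beta2_00 X x y)"

text \<open>The counterpart for slot 1. It occurs twice in the identity, the second time with
  \<open>x\<close> and \<open>y\<close> exchanged.\<close>

definition pair1 :: "('k, 'h, 'a, 'b) two_term \<Rightarrow> ('k, 'h, 'a, 'b) two_term \<Rightarrow> ('k, 'h, 'a, 'b) mor
    \<Rightarrow> 'a \<Rightarrow> 'a \<Rightarrow> 'a \<Rightarrow> ('h list \<times> 'b \<Rightarrow>\<^sub>0 'k) set" where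
  "pair1 X Y f x y z = plug H (L1 Y) 2 1 2 (\<lambda>e. beta2_01 Y (mor0 f x) e) (mor2 f y z)
     \<boxplus> plug H (L1 Y) 2 1 2 (\<lambda>e. mor2 f x e) (beta2_00 X y z)"

context
  fixes X Y :: "('k, 'h, 'a, 'b) two_term" and f :: "('k, 'h, 'a, 'b) mor"
  assumes X: "two_term_Linf_pseudoalgebra H X" and Y: "two_term_Linf_pseudoalgebra H Y"
    and f0: "H_linear (L0 X) (L0 Y) (mor0 f)" and f2: "polylinear2 H (L0 X) (L0 X) (L1 Y) (mor2 f)"
begin

interpretation X: two_term_Linf_pseudoalgebra H X by (rule X)
interpretation Y: two_term_Linf_pseudoalgebra H Y by (rule Y)

lemma plug_terms_closed:
  assumes "x \<in> carrier (L0 X)" "y \<in> carrier (L0 X)" "z \<in> carrier (L0 X)"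
  shows "plug H (L1 Y) 2 0 2 (\<lambda>e. beta2_10 Y e (mor0 f z)) (mor2 f x y) \<in> tens H 3 (L1 Y)"
    "plug H (L1 Y) 2 0 2 (\<lambda>e. mor2 f e z) (beta2_00 X x y) \<in> tens H 3 (L1 Y)"
    "plug H (L1 Y) 2 1 2 (\<lambda>e. beta2_01 Y (mor0 f x) e) (mor2 f y z) \<in> tens H 3 (L1 Y)"
    "plug H (L1 Y) 2 1 2 (\<lambda>e. mor2 f x e) (beta2_00 X y z) \<in> tens H 3 (L1 Y)"
proof -
  have f: "mor0 f x \<in> carrier (L0 Y)" "mor0 f z \<in> carrier (L0 Y)"
    using f0 assms by (auto simp: H_linear_def)
  note c = polylinear2_closed[OF f2] polylinear2_closed[OF X.beta2_00_polylinear]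
  show "plug H (L1 Y) 2 0 2 (\<lambda>e. beta2_10 Y e (mor0 f z)) (mor2 f x y) \<in> tens H 3 (L1 Y)"
    by (rule plug_closed[OF Y.module1 polylinear2_slot0[OF Y.beta2_10_polylinear Y.module0 f(2)]])
      (simp_all add: c assms)
  show "plug H (L1 Y) 2 0 2 (\<lambda>e. mor2 f e z) (beta2_00 X x y) \<in> tens H 3 (L1 Y)"
    by (rule plug_closed[OF Y.module1 polylinear2_slot0[OF f2 X.module0 assms(3)]])
      (simp_all add: c assms)
  show "plug H (L1 Y) 2 1 2 (\<lambda>e. beta2_01 Y (mor0 f x) e) (mor2 f y z) \<in> tens H 3 (L1 Y)"
    by (rule plug_closed[OF Y.module1 polylinear2_slot1[OF Y.beta2_01_polylinear Y.module0 f(1)]])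
      (simp_all add: c assms)
  show "plug H (L1 Y) 2 1 2 (\<lambda>e. mor2 f x e) (beta2_00 X y z) \<in> tens H 3 (L1 Y)"
    by (rule plug_closed[OF Y.module1 polylinear2_slot1[OF f2 X.module0 assms(1)]])
      (simp_all add: c assms)
qed

lemma pair_closed:
  assumes "x \<in> carrier (L0 X)" "y \<in> carrier (L0 X)" "z \<in> carrier (L0 X)"
  shows "pair0 X Y f x y z \<in> tens H 3 (L1 Y)" "pair1 X Y f x y z \<in> tens H 3 (L1 Y)"
  unfolding pair0_def pair1_def by (intro tens_class_add_closed plug_terms_closed assms)+

text \<open>Proved from linearity of \<open>mor0 f\<close> and polylinearity of
  \<open>mor2 f\<close> alone, so that it applies to a composite or an identity whose morphism
  property is still being established.\<close>

lemma mor_beta3_lhs: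
  assumes x: "x \<in> carrier (L0 X)" and y: "y \<in> carrier (L0 X)" and z: "z \<in> carrier (L0 X)"
  shows "plug H (L1 Y) 2 0 2 (\<lambda>e. beta2_10 Y e (mor0 f z)) (mor2 f x y)
      \<boxminus> plug H (L1 Y) 2 1 2 (\<lambda>e. beta2_01 Y (mor0 f x) e) (mor2 f y z)
      \<boxplus> arrange H (L1 Y) [1, 0, 2] (plug H (L1 Y) 2 1 2 (\<lambda>e. beta2_01 Y (mor0 f y) e) (mor2 f x z))
      \<boxplus> plug H (L1 Y) 2 0 2 (\<lambda>e. mor2 f e z) (beta2_00 X x y)
      \<boxminus> plug H (L1 Y) 2 1 2 (\<lambda>e. mor2 f x e) (beta2_00 X y z)
      \<boxplus> arrange H (L1 Y) [1, 0, 2] (plug H (L1 Y) 2 1 2 (\<lambda>e. mor2 f y e) (beta2_00 X x z))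
    = alternating_sum (L1 Y) (pair0 X Y f x y z) (pair1 X Y f x y z) (pair1 X Y f y x z)"
  unfolding pair0_def pair1_def
  by (rule six_terms_eq_alternating_sum[OF Y.module1 plug_terms_closed(1)[OF x y z] plug_terms_closed(3)[OF x y z]
        plug_terms_closed(3)[OF y x z] plug_terms_closed(2)[OF x y z] plug_terms_closed(4)[OF x y z]
        plug_terms_closed(4)[OF y x z]])

end

section \<open>Composites of morphisms\<close>

lemma H_linear_compose:
  assumes "left_module M" "H_linear M N f" "H_linear N K g"
  shows "H_linear M K (compose (carrier M) g f)"
proof -
  interpret M: abelian_group M by (rule left_module.abelian_group[OF assms(1)])
  show ?thesis
    using assms(2,3) left_module.smult_closed[OF assms(1)]
    by (auto simp: H_linear_def compose_def Pi_iff)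
qed

lemma H_linear_restrict_id:
  assumes "left_module M"
  shows "H_linear M M (\<lambda>x\<in>carrier M. x)"
proof -
  interpret M: abelian_group M by (rule left_module.abelian_group[OF assms])
  show ?thesis
    using left_module.smult_closed[OF assms] by (auto simp: H_linear_def)
qed

lemma mor_comp_morphism:
  assumes X: "two_term_Linf_pseudoalgebra H X" and Y: "two_term_Linf_pseudoalgebra H Y"
    and Z: "two_term_Linf_pseudoalgebra H Z"
    and f: "two_term_morphism H X Y f" and g: "two_term_morphism H Y Z g"
  shows "two_term_morphism H X Z (mor_comp H X Y Z g f)"
proof -
  interpret X: two_term_Linf_pseudoalgebra H X by fact
  interpret Y: two_term_Linf_pseudoalgebra H Y by fact
  interpret Z: two_term_Linf_pseudoalgebra H Z by fact
  interpret f: two_term_morphism H X Y f by fact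
  interpret g: two_term_morphism H Y Z g by fact
  let ?h = "mor_comp H X Y Z g f"
  have f0: "x \<in> carrier (L0 X) \<Longrightarrow> mor0 f x \<in> carrier (L0 Y)" for x
    using f.mor0_linear by (auto simp: H_linear_def)
  have f1: "u \<in> carrier (L1 X) \<Longrightarrow> mor1 f u \<in> carrier (L1 Y)" for u
    using f.mor1_linear by (auto simp: H_linear_def)
  have g0: "x \<in> carrier (L0 Y) \<Longrightarrow> mor0 g x \<in> carrier (L0 Z)" for x
    using g.mor0_linear by (auto simp: H_linear_def)
  have g1: "u \<in> carrier (L1 Y) \<Longrightarrow> mor1 g u \<in> carrier (L1 Z)" for u
    using g.mor1_linear by (auto simp: H_linear_def)
  have b1: "u \<in> carrier (L1 X) \<Longrightarrow> beta1 X u \<in> carrier (L0 X)" for u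
    using X.beta1_linear by (auto simp: H_linear_def)
  have h0: "mor0 ?h x = mor0 g (mor0 f x)" if "x \<in> carrier (L0 X)" for x
    using that by (simp add: mor_comp_def compose_def)
  have h1: "mor1 ?h u = mor1 g (mor1 f u)" if "u \<in> carrier (L1 X)" for u
    using that by (simp add: mor_comp_def compose_def)
  have h2: "mor2 ?h x y = mor2 g (mor0 f x) (mor0 f y) \<boxplus> tens_map H 2 (L1 Z) (mor1 g) (mor2 f x y)"
    if "x \<in> carrier (L0 X)" "y \<in> carrier (L0 X)" for x y
    using that by (simp add: mor_comp_def)
  have h0_linear: "H_linear (L0 X) (L0 Z) (mor0 ?h)"
    unfolding mor_comp_def using H_linear_compose[OF X.module0 f.mor0_linear g.mor0_linear] by simp
  have h1_linear: "H_linear (L1 X) (L1 Z) (mor1 ?h)"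
    unfolding mor_comp_def using H_linear_compose[OF X.module1 f.mor1_linear g.mor1_linear] by simp
  note G2 = polylinear2_pullback[OF g.mor2_polylinear f.mor0_linear]
  note F2 = polylinear2_tens_map[OF f.mor2_polylinear Y.module1 g.mor1_linear]
  have map_h0: "tens_map H n (L0 Z) (mor0 ?h) A = tens_map H n (L0 Z) (mor0 g) (tens_map H n (L0 Y) (mor0 f) A)"
    if "A \<in> tens H n (L0 X)" for n A
    using tens_map_comp[OF X.module0 g.mor0_linear that, of "mor0 f" "mor0 ?h"] by (simp add: h0)
  have map_h1: "tens_map H n (L1 Z) (mor1 ?h) A = tens_map H n (L1 Z) (mor1 g) (tens_map H n (L1 Y) (mor1 f) A)"
    if "A \<in> tens H n (L1 X)" for n A
    using tens_map_comp[OF X.module1 g.mor1_linear that, of "mor1 f" "mor1 ?h"] by (simp add: h1)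
  note f2_closed = polylinear2_closed[OF f.mor2_polylinear]
  note g2_closed = polylinear2_closed[OF g.mor2_polylinear]
  note X00 = polylinear2_closed[OF X.beta2_00_polylinear]
  note Y00 = polylinear2_closed[OF Y.beta2_00_polylinear]
  note Z00 = polylinear2_closed[OF Z.beta2_00_polylinear]
  note X01 = polylinear2_closed[OF X.beta2_01_polylinear]
  note Y01 = polylinear2_closed[OF Y.beta2_01_polylinear]
  note Z01 = polylinear2_closed[OF Z.beta2_01_polylinear]
  have zero_less_two: "(0 :: nat) < 2" and one_less_two: "(1 :: nat) < 2" by simp_all
  \<comment> \<open>Instance of \<open>plug_pair\<close> with \<open>W = mor2 f x y\<close>,
    \<open>V = beta2_00 X x y\<close>, \<open>V'\<close> the bracket of the images in
    \<open>Y\<close>, \<open>W2\<close> the value of \<open>mor2 g\<close> on them, and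
    \<open>K\<close> the map \<open>mor2 g\<close> with second argument frozen at
    \<open>mor0 f z\<close>. Its relation \<open>rel\<close> is the degree (1,0) identity for
    \<open>g\<close>.\<close>
  have pair0_comp: "pair0 X Z ?h x y z = pair0 Y Z g (mor0 f x) (mor0 f y) (mor0 f z)
      \<boxplus> tens_map H 3 (L1 Z) (mor1 g) (pair0 X Y f x y z)"
    if x: "x \<in> carrier (L0 X)" and y: "y \<in> carrier (L0 X)" and z: "z \<in> carrier (L0 X)" for x y z
  proof -
    have "plug H (L1 Z) 2 0 2 (\<lambda>e. mor2 ?h e z) (beta2_00 X x y)
        = plug H (L1 Z) 2 0 2 (\<lambda>e. mor2 g (mor0 f e) (mor0 f z) \<boxplus> tens_map H 2 (L1 Z) (mor1 g) (mor2 f e z)) (beta2_00 X x y)"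
      by (rule plug_cong[OF X.module0 X00[OF x y]]) (simp add: h2 z)
    then show ?thesis
      unfolding pair0_def h0[OF z] h2[OF x y]
      by (simp only: plug_pair[OF X.module0 Y.module0 Y.module1 Z.module1 zero_less_two g.mor1_linear Y.beta1_linear f.mor0_linear
          polylinear2_slot0[OF Y.beta2_10_polylinear Y.module0 f0[OF z]]
          polylinear2_slot0[OF Z.beta2_10_polylinear Z.module0 g0[OF f0[OF z]]]
          polylinear2_slot0[OF g.mor2_polylinear Y.module0 f0[OF z]]
          polylinear2_slot0[OF f.mor2_polylinear X.module0 z]
          mor_beta2_10[OF Y Z g _ f0[OF z]] g2_closed[OF f0[OF x] f0[OF y]] f2_closed[OF x y] X00[OF x y]
          Y00[OF f0[OF x] f0[OF y]] f.mor_beta2_00[OF x y]])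
  qed
  \<comment> \<open>As for \<open>pair0_comp\<close>, but in slot 1, where the postulated degree
    (0,1) identity for \<open>g\<close> serves as \<open>rel\<close>.\<close>
  have pair1_comp: "pair1 X Z ?h x y z = pair1 Y Z g (mor0 f x) (mor0 f y) (mor0 f z)
      \<boxplus> tens_map H 3 (L1 Z) (mor1 g) (pair1 X Y f x y z)"
    if x: "x \<in> carrier (L0 X)" and y: "y \<in> carrier (L0 X)" and z: "z \<in> carrier (L0 X)" for x y z
  proof -
    have "plug H (L1 Z) 2 1 2 (\<lambda>e. mor2 ?h x e) (beta2_00 X y z)
        = plug H (L1 Z) 2 1 2 (\<lambda>e. mor2 g (mor0 f x) (mor0 f e) \<boxplus> tens_map H 2 (L1 Z) (mor1 g) (mor2 f x e)) (beta2_00 X y z)"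
      by (rule plug_cong[OF X.module0 X00[OF y z]]) (simp add: h2 x)
    then show ?thesis
      unfolding pair1_def h0[OF x] h2[OF y z]
      by (simp only: plug_pair[OF X.module0 Y.module0 Y.module1 Z.module1 one_less_two g.mor1_linear Y.beta1_linear f.mor0_linear
          polylinear2_slot1[OF Y.beta2_01_polylinear Y.module0 f0[OF x]]
          polylinear2_slot1[OF Z.beta2_01_polylinear Z.module0 g0[OF f0[OF x]]]
          polylinear2_slot1[OF g.mor2_polylinear Y.module0 f0[OF x]]
          polylinear2_slot1[OF f.mor2_polylinear X.module0 x]
          g.mor_beta2_01[OF f0[OF x]] g2_closed[OF f0[OF y] f0[OF z]] f2_closed[OF y z] X00[OF y z]
          Y00[OF f0[OF y] f0[OF z]] f.mor_beta2_00[OF y z]])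
  qed
  note mapg1 = tens_map_closed[OF g.mor1_linear]
  show ?thesis
  proof
    show "H_linear (L0 X) (L0 Z) (mor0 ?h)" by (rule h0_linear)
    show "H_linear (L1 X) (L1 Z) (mor1 ?h)" by (rule h1_linear)
    show "mor0 ?h \<in> extensional (carrier (L0 X))" "mor1 ?h \<in> extensional (carrier (L1 X))"
      "mor2 ?h \<in> extensional (carrier (L0 X))"
      by (simp_all add: mor_comp_def compose_extensional)
    show "mor2 ?h x \<in> extensional (carrier (L0 X))" if "x \<in> carrier (L0 X)" for x
      using that by (simp add: mor_comp_def)
    show "polylinear2 H (L0 X) (L0 X) (L1 Z) (mor2 ?h)"
      unfolding mor_comp_def mor.simps by (intro polylinear2_restrict X.module0 polylinear2_add G2 F2)
    show "skew2 H (L0 X) (L1 Z) (mor2 ?h)"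
      unfolding mor_comp_def mor.simps
      by (intro skew2_restrict skew2_add G2 F2 Z.module1 skew2_pullback[OF g.mor2_skew f.mor0_linear]
          skew2_tens_map[OF f.mor2_polylinear f.mor2_skew Y.module1 Z.module1 g.mor1_linear])
    show "beta1 Z (mor1 ?h u) = mor0 ?h (beta1 X u)" if "u \<in> carrier (L1 X)" for u
      using that by (simp add: h0 h1 b1 f1 f.mor_beta1[symmetric] g.mor_beta1)
  next
    fix x y assume x: "x \<in> carrier (L0 X)" and y: "y \<in> carrier (L0 X)"
    note c = tens_map_closed[OF g.mor0_linear tens_map_closed[OF f.mor0_linear X00[OF x y]]]
      tens_map_closed[OF g.mor0_linear Y00[OF f0[OF x] f0[OF y]]] Z00[OF g0[OF f0[OF x]] g0[OF f0[OF y]]]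
    \<comment> \<open>Both sides are induced by the same composite of linear maps, since
      \<open>g\<close> commutes with \<open>\<beta>\<^sub>1\<close>.\<close>
    have "tens_map H 2 (L0 Z) (beta1 Z) (tens_map H 2 (L1 Z) (mor1 g) (mor2 f x y))
        = tens_map H 2 (L0 Z) (mor0 g) (tens_map H 2 (L0 Y) (beta1 Y) (mor2 f x y))"
      using tens_map_comp[OF Y.module1 Z.beta1_linear f2_closed[OF x y] g.mor_beta1]
        tens_map_comp[OF Y.module1 g.mor0_linear f2_closed[OF x y] refl] by simp
    also have "\<dots> = tens_map H 2 (L0 Z) (mor0 g) (tens_map H 2 (L0 Y) (mor0 f) (beta2_00 X x y))
        \<boxminus> tens_map H 2 (L0 Z) (mor0 g) (beta2_00 Y (mor0 f x) (mor0 f y))"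
      unfolding f.mor_beta2_00[OF x y, symmetric]
      by (rule tens_map_diff[OF g.mor0_linear tens_map_closed[OF f.mor0_linear X00[OF x y]] Y00[OF f0[OF x] f0[OF y]]])
    finally have "tens_map H 2 (L0 Z) (beta1 Z) (mor2 ?h x y)
        = tens_map H 2 (L0 Z) (mor0 g) (tens_map H 2 (L0 Y) (mor0 f) (beta2_00 X x y))
          \<boxminus> beta2_00 Z (mor0 g (mor0 f x)) (mor0 g (mor0 f y))"
      unfolding h2[OF x y] tens_map_add[OF Z.beta1_linear g2_closed[OF f0[OF x] f0[OF y]] mapg1[OF f2_closed[OF x y]]]
        g.mor_beta2_00[OF f0[OF x] f0[OF y], symmetric]
      by (simp only: telescope[OF c])
    then show "tens_map H 2 (L0 Z) (mor0 ?h) (beta2_00 X x y) \<boxminus> beta2_00 Z (mor0 ?h x) (mor0 ?h y)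
        = tens_map H 2 (L0 Z) (beta1 Z) (mor2 ?h x y)"
      by (simp only: map_h0[OF X00[OF x y]] h0 x y)
  next
    fix x u assume x: "x \<in> carrier (L0 X)" and u: "u \<in> carrier (L1 X)"
    note c = mapg1[OF tens_map_closed[OF f.mor1_linear X01[OF x u]]] mapg1[OF Y01[OF f0[OF x] f1[OF u]]]
      Z01[OF g0[OF f0[OF x]] g1[OF f1[OF u]]]
    \<comment> \<open>Moving \<open>f\<close> past \<open>\<beta>\<^sub>1\<close> brings the second
      argument into the form to which the degree (0,1) identity for \<open>g\<close>
      applies.\<close>
    have "mor2 ?h x (beta1 X u) = mor2 g (mor0 f x) (beta1 Y (mor1 f u))
        \<boxplus> tens_map H 2 (L1 Z) (mor1 g) (mor2 f x (beta1 X u))"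
      by (simp add: h2[OF x b1[OF u]] f.mor_beta1[OF u])
    also have "\<dots> = tens_map H 2 (L1 Z) (mor1 g) (tens_map H 2 (L1 Y) (mor1 f) (beta2_01 X x u))
        \<boxminus> beta2_01 Z (mor0 g (mor0 f x)) (mor1 g (mor1 f u))"
      unfolding f.mor_beta2_01[OF x u, symmetric] g.mor_beta2_01[OF f0[OF x] f1[OF u], symmetric]
        tens_map_diff[OF g.mor1_linear tens_map_closed[OF f.mor1_linear X01[OF x u]] Y01[OF f0[OF x] f1[OF u]]]
      by (rule telescope[OF c])
    finally show "tens_map H 2 (L1 Z) (mor1 ?h) (beta2_01 X x u) \<boxminus> beta2_01 Z (mor0 ?h x) (mor1 ?h u)
        = mor2 ?h x (beta1 X u)"
      by (simp only: map_h1[OF X01[OF x u]] h0[OF x] h1[OF u])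
  next
    fix x y z assume x: "x \<in> carrier (L0 X)" and y: "y \<in> carrier (L0 X)" and z: "z \<in> carrier (L0 X)"
    note fx = f0[OF x] and fy = f0[OF y] and fz = f0[OF z]
    note gc = pair_closed[OF Y Z g.mor0_linear g.mor2_polylinear]
    note fc = pair_closed[OF X Y f.mor0_linear f.mor2_polylinear]
    have "polylinear2 H (L0 X) (L0 X) (L1 Z) (mor2 ?h)"
      unfolding mor_comp_def mor.simps by (intro polylinear2_restrict X.module0 polylinear2_add G2 F2)
    note lhs = mor_beta3_lhs[OF X Z h0_linear this x y z]
    have b: "beta3 X x y z \<in> tens H 3 (L1 X)" "beta3 Y (mor0 f x) (mor0 f y) (mor0 f z) \<in> tens H 3 (L1 Y)"
      "beta3 Z (mor0 g (mor0 f x)) (mor0 g (mor0 f y)) (mor0 g (mor0 f z)) \<in> tens H 3 (L1 Z)"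
      using X.beta3_polylinear Y.beta3_polylinear Z.beta3_polylinear x y z f0 g0 by (simp_all add: polylinear3_def)
    note fb = tens_map_closed[OF f.mor1_linear b(1)]
    have "alternating_sum (L1 Z) (pair0 X Z ?h x y z) (pair1 X Z ?h x y z) (pair1 X Z ?h y x z)
        = alternating_sum (L1 Z) (pair0 Y Z g (mor0 f x) (mor0 f y) (mor0 f z))
            (pair1 Y Z g (mor0 f x) (mor0 f y) (mor0 f z)) (pair1 Y Z g (mor0 f y) (mor0 f x) (mor0 f z))
          \<boxplus> tens_map H 3 (L1 Z) (mor1 g)
              (alternating_sum (L1 Y) (pair0 X Y f x y z) (pair1 X Y f x y z) (pair1 X Y f y x z))"
      unfolding pair0_comp[OF x y z] pair1_comp[OF x y z] pair1_comp[OF y x z]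
        tens_map_alternating_sum[OF Y.module1 g.mor1_linear fc(1)[OF x y z] fc(2)[OF x y z] fc(2)[OF y x z]]
      by (intro alternating_sum_add gc mapg1 fc fx fy fz x y z)
    \<comment> \<open>The identity for \<open>g\<close> is used at the images under
      \<open>f\<close>, and \<open>mor1 g\<close> is applied to the identity for \<open>f\<close>;
      their common \<open>beta3 Y\<close> term then cancels by \<open>telescope\<close>.\<close>
    also have "\<dots> = (beta3 Z (mor0 g (mor0 f x)) (mor0 g (mor0 f y)) (mor0 g (mor0 f z))
          \<boxminus> tens_map H 3 (L1 Z) (mor1 g) (beta3 Y (mor0 f x) (mor0 f y) (mor0 f z)))
        \<boxplus> (tens_map H 3 (L1 Z) (mor1 g) (beta3 Y (mor0 f x) (mor0 f y) (mor0 f z))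
          \<boxminus> tens_map H 3 (L1 Z) (mor1 g) (tens_map H 3 (L1 Y) (mor1 f) (beta3 X x y z)))"
      using g.mor_beta3[OF fx fy fz] f.mor_beta3[OF x y z]
      unfolding mor_beta3_lhs[OF Y Z g.mor0_linear g.mor2_polylinear fx fy fz]
        mor_beta3_lhs[OF X Y f.mor0_linear f.mor2_polylinear x y z]
      by (simp only: tens_map_diff[OF g.mor1_linear b(2) fb])
    also have "\<dots> = beta3 Z (mor0 g (mor0 f x)) (mor0 g (mor0 f y)) (mor0 g (mor0 f z))
          \<boxminus> tens_map H 3 (L1 Z) (mor1 g) (tens_map H 3 (L1 Y) (mor1 f) (beta3 X x y z))"
      unfolding cplus_commute[of "beta3 Z _ _ _ \<boxminus> _"] by (rule telescope[OF b(3) mapg1[OF b(2)] mapg1[OF fb]])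
    finally show "plug H (L1 Z) 2 0 2 (\<lambda>e. beta2_10 Z e (mor0 ?h z)) (mor2 ?h x y)
          \<boxminus> plug H (L1 Z) 2 1 2 (\<lambda>e. beta2_01 Z (mor0 ?h x) e) (mor2 ?h y z)
          \<boxplus> arrange H (L1 Z) [1, 0, 2] (plug H (L1 Z) 2 1 2 (\<lambda>e. beta2_01 Z (mor0 ?h y) e) (mor2 ?h x z))
          \<boxplus> plug H (L1 Z) 2 0 2 (\<lambda>e. mor2 ?h e z) (beta2_00 X x y)
          \<boxminus> plug H (L1 Z) 2 1 2 (\<lambda>e. mor2 ?h x e) (beta2_00 X y z)
          \<boxplus> arrange H (L1 Z) [1, 0, 2] (plug H (L1 Z) 2 1 2 (\<lambda>e. mor2 ?h y e) (beta2_00 X x z))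
          = beta3 Z (mor0 ?h x) (mor0 ?h y) (mor0 ?h z) \<boxminus> tens_map H 3 (L1 Z) (mor1 ?h) (beta3 X x y z)"
      unfolding lhs unfolding map_h1[OF b(1)] h0[OF x] h0[OF y] h0[OF z] .
  qed
qed

section \<open>Identity morphisms\<close>

definition id_mor :: "('k, 'h, 'a, 'b) two_term \<Rightarrow> ('k, 'h, 'a, 'b) mor" where
  "id_mor X = \<lparr> mor0 = (\<lambda>x\<in>carrier (L0 X). x), mor1 = (\<lambda>u\<in>carrier (L1 X). u),
     mor2 = (\<lambda>x\<in>carrier (L0 X). \<lambda>y\<in>carrier (L0 X). tens_class H 2 (L1 X) 0) \<rparr>"

lemma id_mor_morphism:
  assumes X: "two_term_Linf_pseudoalgebra H X"
  shows "two_term_morphism H X X (id_mor X)"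
proof -
  interpret X: two_term_Linf_pseudoalgebra H X by fact
  let ?i = "id_mor X"
  have b1: "u \<in> carrier (L1 X) \<Longrightarrow> beta1 X u \<in> carrier (L0 X)" for u
    using X.beta1_linear by (auto simp: H_linear_def)
  have i0: "x \<in> carrier (L0 X) \<Longrightarrow> mor0 ?i x = x" for x by (simp add: id_mor_def)
  have i1: "u \<in> carrier (L1 X) \<Longrightarrow> mor1 ?i u = u" for u by (simp add: id_mor_def)
  have i2: "x \<in> carrier (L0 X) \<Longrightarrow> y \<in> carrier (L0 X) \<Longrightarrow> mor2 ?i x y = tens_class H 2 (L1 X) 0" for x y
    by (simp add: id_mor_def)
  have i0_linear: "H_linear (L0 X) (L0 X) (mor0 ?i)"
    unfolding id_mor_def using H_linear_restrict_id[OF X.module0] by simp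
  have i1_linear: "H_linear (L1 X) (L1 X) (mor1 ?i)"
    unfolding id_mor_def using H_linear_restrict_id[OF X.module1] by simp
  have i2_polylinear: "polylinear2 H (L0 X) (L0 X) (L1 X) (mor2 ?i)"
    unfolding id_mor_def mor.simps by (intro polylinear2_restrict X.module0 polylinear2_zero)
  note X00 = polylinear2_closed[OF X.beta2_00_polylinear]
  note X01 = polylinear2_closed[OF X.beta2_01_polylinear]
  show ?thesis
  proof
    show "H_linear (L0 X) (L0 X) (mor0 ?i)" "H_linear (L1 X) (L1 X) (mor1 ?i)"
      "polylinear2 H (L0 X) (L0 X) (L1 X) (mor2 ?i)"
      by (fact i0_linear i1_linear i2_polylinear)+
    show "mor0 ?i \<in> extensional (carrier (L0 X))" "mor1 ?i \<in> extensional (carrier (L1 X))"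
      "mor2 ?i \<in> extensional (carrier (L0 X))"
      by (simp_all add: id_mor_def)
    show "mor2 ?i x \<in> extensional (carrier (L0 X))" if "x \<in> carrier (L0 X)" for x
      using that by (simp add: id_mor_def)
    show "skew2 H (L0 X) (L1 X) (mor2 ?i)"
      unfolding id_mor_def mor.simps by (intro skew2_restrict skew2_zero X.module1)
    show "beta1 X (mor1 ?i u) = mor0 ?i (beta1 X u)" if "u \<in> carrier (L1 X)" for u
      using that by (simp add: i0 i1 b1)
    show "tens_map H 2 (L0 X) (mor0 ?i) (beta2_00 X x y) \<boxminus> beta2_00 X (mor0 ?i x) (mor0 ?i y)
        = tens_map H 2 (L0 X) (beta1 X) (mor2 ?i x y)"
      if "x \<in> carrier (L0 X)" "y \<in> carrier (L0 X)" for x y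
      using that X00[OF that]
      by (simp add: i0 i2 tens_map_id[OF X.module0] tens_map_zero[OF X.beta1_linear] cminus_self)
    show "tens_map H 2 (L1 X) (mor1 ?i) (beta2_01 X x u) \<boxminus> beta2_01 X (mor0 ?i x) (mor1 ?i u) = mor2 ?i x (beta1 X u)"
      if "x \<in> carrier (L0 X)" "u \<in> carrier (L1 X)" for x u
      using that X01[OF that] by (simp add: i0 i1 i2 b1 tens_map_id[OF X.module1] cminus_self)
  next
    fix x y z assume x: "x \<in> carrier (L0 X)" and y: "y \<in> carrier (L0 X)" and z: "z \<in> carrier (L0 X)"
    note zero = zero_tens[of H 3 "L1 X"]
    \<comment> \<open>One term vanishes because zero is inserted into the bracket, the other because
      the map into which the bracket is inserted is zero.\<close>
    have pair0: "pair0 X X ?i x y z = tens_class H 3 (L1 X) 0" if "x \<in> carrier (L0 X)" "y \<in> carrier (L0 X)" "z \<in> carrier (L0 X)" for x y z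
    proof -
      have "plug H (L1 X) 2 0 2 (\<lambda>e. mor2 ?i e z) (beta2_00 X x y) = tens_class H 3 (L1 X) 0"
        using plug_zero_fun[OF X.module0 _ X00[OF that(1,2)], where N = "L1 X" and m = 0]
          plug_cong[OF X.module0 X00[OF that(1,2)],
            where N = "L1 X" and m = 0 and G = "\<lambda>e. mor2 ?i e z" and G' = "\<lambda>e. tens_class H 2 (L1 X) 0"] that
        by (simp add: i2)
      moreover have "plug H (L1 X) 2 0 2 (\<lambda>e. beta2_10 X e z) (tens_class H 2 (L1 X) 0) = tens_class H 3 (L1 X) 0"
        by (rule plug_zero[OF X.module1 polylinear2_slot0[OF X.beta2_10_polylinear X.module0 that(3)]]) simp
      ultimately show ?thesis using that by (simp add: pair0_def i0 i2 cplus_zero[OF zero])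
    qed
    have pair1: "pair1 X X ?i x y z = tens_class H 3 (L1 X) 0" if "x \<in> carrier (L0 X)" "y \<in> carrier (L0 X)" "z \<in> carrier (L0 X)" for x y z
    proof -
      have "plug H (L1 X) 2 1 2 (\<lambda>e. mor2 ?i x e) (beta2_00 X y z) = tens_class H 3 (L1 X) 0"
        using plug_zero_fun[OF X.module0 _ X00[OF that(2,3)], where N = "L1 X" and m = 1]
          plug_cong[OF X.module0 X00[OF that(2,3)],
            where N = "L1 X" and m = 1 and G = "\<lambda>e. mor2 ?i x e" and G' = "\<lambda>e. tens_class H 2 (L1 X) 0"] that
        by (simp add: i2)
      moreover have "plug H (L1 X) 2 1 2 (\<lambda>e. beta2_01 X x e) (tens_class H 2 (L1 X) 0) = tens_class H 3 (L1 X) 0"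
        by (rule plug_zero[OF X.module1 polylinear2_slot1[OF X.beta2_01_polylinear X.module0 that(1)]]) simp
      ultimately show ?thesis using that by (simp add: pair1_def i0 i2 cplus_zero[OF zero])
    qed
    have "beta3 X x y z \<in> tens H 3 (L1 X)"
      using X.beta3_polylinear x y z by (simp add: polylinear3_def)
    then have "alternating_sum (L1 X) (pair0 X X ?i x y z) (pair1 X X ?i x y z) (pair1 X X ?i y x z)
        = beta3 X (mor0 ?i x) (mor0 ?i y) (mor0 ?i z) \<boxminus> tens_map H 3 (L1 X) (mor1 ?i) (beta3 X x y z)"
      by (simp add: pair0 pair1 x y z i0 i1 tens_map_id[OF X.module1] cminus_self[OF zero] cminus_self
          alternating_sum_def swapped_zero cplus_zero[OF zero])
    then show "plug H (L1 X) 2 0 2 (\<lambda>e. beta2_10 X e (mor0 ?i z)) (mor2 ?i x y)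
          \<boxminus> plug H (L1 X) 2 1 2 (\<lambda>e. beta2_01 X (mor0 ?i x) e) (mor2 ?i y z)
          \<boxplus> arrange H (L1 X) [1, 0, 2] (plug H (L1 X) 2 1 2 (\<lambda>e. beta2_01 X (mor0 ?i y) e) (mor2 ?i x z))
          \<boxplus> plug H (L1 X) 2 0 2 (\<lambda>e. mor2 ?i e z) (beta2_00 X x y)
          \<boxminus> plug H (L1 X) 2 1 2 (\<lambda>e. mor2 ?i x e) (beta2_00 X y z)
          \<boxplus> arrange H (L1 X) [1, 0, 2] (plug H (L1 X) 2 1 2 (\<lambda>e. mor2 ?i y e) (beta2_00 X x z))
          = beta3 X (mor0 ?i x) (mor0 ?i y) (mor0 ?i z) \<boxminus> tens_map H 3 (L1 X) (mor1 ?i) (beta3 X x y z)"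
      unfolding mor_beta3_lhs[OF X X i0_linear i2_polylinear x y z] .
  qed
qed

section \<open>The category laws\<close>

lemma mor_eqI:
  assumes f: "two_term_morphism H X Y f" and g: "two_term_morphism H X Y g"
    and "\<And>x. x \<in> carrier (L0 X) \<Longrightarrow> mor0 f x = mor0 g x"
    and "\<And>u. u \<in> carrier (L1 X) \<Longrightarrow> mor1 f u = mor1 g u"
    and "\<And>x y. x \<in> carrier (L0 X) \<Longrightarrow> y \<in> carrier (L0 X) \<Longrightarrow> mor2 f x y = mor2 g x y"
  shows "f = g"
proof -
  interpret f: two_term_morphism H X Y f by fact
  interpret g: two_term_morphism H X Y g by fact
  have "mor0 f = mor0 g" using f.mor0_ext g.mor0_ext assms(3) by (rule extensionalityI)
  moreover have "mor1 f = mor1 g" using f.mor1_ext g.mor1_ext assms(4) by (rule extensionalityI)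
  moreover have "mor2 f = mor2 g"
  proof (rule extensionalityI[OF f.mor2_ext(1) g.mor2_ext(1)])
    fix x assume x: "x \<in> carrier (L0 X)"
    show "mor2 f x = mor2 g x"
      by (rule extensionalityI[OF f.mor2_ext(2)[OF x] g.mor2_ext(2)[OF x] assms(5)[OF x]])
  qed
  ultimately show ?thesis by simp
qed

text \<open>On the binary component both sides are the sum of \<open>h\<^sub>2\<close> at the images
  under \<open>g\<^sub>0 f\<^sub>0\<close>, \<open>h\<^sub>1\<close> of \<open>g\<^sub>2\<close> at
  the images under \<open>f\<^sub>0\<close>, and \<open>h\<^sub>1 g\<^sub>1 f\<^sub>2\<close>;
  additivity of the map induced by \<open>h\<^sub>1\<close> and associativity of
  \<open>\<boxplus>\<close> match them.\<close>

lemma mor_comp_assoc: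
  assumes X: "two_term_Linf_pseudoalgebra H X" and Y: "two_term_Linf_pseudoalgebra H Y"
    and Z: "two_term_Linf_pseudoalgebra H Z" and W: "two_term_Linf_pseudoalgebra H W"
    and f: "two_term_morphism H X Y f" and g: "two_term_morphism H Y Z g" and h: "two_term_morphism H Z W h"
  shows "mor_comp H X Z W h (mor_comp H X Y Z g f) = mor_comp H X Y W (mor_comp H Y Z W h g) f"
proof (rule mor_eqI[OF mor_comp_morphism[OF X Z W mor_comp_morphism[OF X Y Z f g] h]
      mor_comp_morphism[OF X Y W f mor_comp_morphism[OF Y Z W g h]]])
  interpret X: two_term_Linf_pseudoalgebra H X by fact
  interpret Y: two_term_Linf_pseudoalgebra H Y by fact
  interpret Z: two_term_Linf_pseudoalgebra H Z by fact
  interpret f: two_term_morphism H X Y f by fact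
  interpret g: two_term_morphism H Y Z g by fact
  interpret h: two_term_morphism H Z W h by fact
  have f0: "x \<in> carrier (L0 X) \<Longrightarrow> mor0 f x \<in> carrier (L0 Y)" for x
    using f.mor0_linear by (auto simp: H_linear_def)
  have f1: "u \<in> carrier (L1 X) \<Longrightarrow> mor1 f u \<in> carrier (L1 Y)" for u
    using f.mor1_linear by (auto simp: H_linear_def)
  show "mor0 (mor_comp H X Z W h (mor_comp H X Y Z g f)) x = mor0 (mor_comp H X Y W (mor_comp H Y Z W h g) f) x"
    if "x \<in> carrier (L0 X)" for x
    using that f0 by (simp add: mor_comp_def compose_def)
  show "mor1 (mor_comp H X Z W h (mor_comp H X Y Z g f)) u = mor1 (mor_comp H X Y W (mor_comp H Y Z W h g) f) u"
    if "u \<in> carrier (L1 X)" for u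
    using that f1 by (simp add: mor_comp_def compose_def)
  fix x y assume x: "x \<in> carrier (L0 X)" and y: "y \<in> carrier (L0 X)"
  \<comment> \<open>The composite of \<open>mor1 h\<close> and \<open>mor1 g\<close> is restricted
    to the carrier; it may replace the plain one because the values of \<open>mor2 f\<close> lie
    over that carrier.\<close>
  have "tens_map H 2 (L1 W) (mor1 h) (mor2 g (mor0 f x) (mor0 f y) \<boxplus> tens_map H 2 (L1 Z) (mor1 g) (mor2 f x y))
      = tens_map H 2 (L1 W) (mor1 h) (mor2 g (mor0 f x) (mor0 f y))
        \<boxplus> tens_map H 2 (L1 W) (compose (carrier (L1 Y)) (mor1 h) (mor1 g)) (mor2 f x y)"
    using polylinear2_closed[OF f.mor2_polylinear x y] polylinear2_closed[OF g.mor2_polylinear f0[OF x] f0[OF y]]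
    by (simp add: tens_map_add[OF h.mor1_linear] tens_map_closed[OF g.mor1_linear]
        tens_map_comp[OF Y.module1 h.mor1_linear, where f = "mor1 g" and k = "compose (carrier (L1 Y)) (mor1 h) (mor1 g)"]
        compose_eq)
  then show "mor2 (mor_comp H X Z W h (mor_comp H X Y Z g f)) x y
      = mor2 (mor_comp H X Y W (mor_comp H Y Z W h g) f) x y"
    using x y f0 by (simp add: mor_comp_def compose_def cplus_assoc)
qed

lemma mor_comp_id_right:
  assumes X: "two_term_Linf_pseudoalgebra H X" and Y: "two_term_Linf_pseudoalgebra H Y"
    and f: "two_term_morphism H X Y f"
  shows "mor_comp H X X Y f (id_mor X) = f"
proof (rule mor_eqI[OF mor_comp_morphism[OF X X Y id_mor_morphism[OF X] f] f])
  interpret f: two_term_morphism H X Y f by fact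
  show "mor2 (mor_comp H X X Y f (id_mor X)) x y = mor2 f x y"
    if "x \<in> carrier (L0 X)" "y \<in> carrier (L0 X)" for x y
    using that polylinear2_closed[OF f.mor2_polylinear that]
    by (simp add: mor_comp_def id_mor_def tens_map_zero[OF f.mor1_linear] cplus_zero)
qed (simp_all add: mor_comp_def id_mor_def compose_def)

lemma mor_comp_id_left:
  assumes X: "two_term_Linf_pseudoalgebra H X" and Y: "two_term_Linf_pseudoalgebra H Y"
    and f: "two_term_morphism H X Y f"
  shows "mor_comp H X Y Y (id_mor Y) f = f"
proof (rule mor_eqI[OF mor_comp_morphism[OF X Y Y f id_mor_morphism[OF Y]] f])
  interpret Y: two_term_Linf_pseudoalgebra H Y by fact
  interpret f: two_term_morphism H X Y f by fact
  have f0: "x \<in> carrier (L0 X) \<Longrightarrow> mor0 f x \<in> carrier (L0 Y)" for x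
    using f.mor0_linear by (auto simp: H_linear_def)
  have f1: "u \<in> carrier (L1 X) \<Longrightarrow> mor1 f u \<in> carrier (L1 Y)" for u
    using f.mor1_linear by (auto simp: H_linear_def)
  show "mor0 (mor_comp H X Y Y (id_mor Y) f) x = mor0 f x" if "x \<in> carrier (L0 X)" for x
    using that f0 by (simp add: mor_comp_def id_mor_def compose_def)
  show "mor1 (mor_comp H X Y Y (id_mor Y) f) u = mor1 f u" if "u \<in> carrier (L1 X)" for u
    using that f1 by (simp add: mor_comp_def id_mor_def compose_def)
  show "mor2 (mor_comp H X Y Y (id_mor Y) f) x y = mor2 f x y"
    if "x \<in> carrier (L0 X)" "y \<in> carrier (L0 X)" for x y
    using that f0 polylinear2_closed[OF f.mor2_polylinear that]
    by (simp add: mor_comp_def id_mor_def tens_map_id[OF Y.module1] cplus_zero)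
qed

end

theorem proposition5p2:
  fixes H :: "('k::field, 'h::ring_1) hopf"
  assumes "cocommutative_hopf_algebra H"
  shows "category (pseudoalgebras H :: ('k, 'h, 'a, 'b) two_term set) (pseudoalgebra_hom H) (mor_comp H)"
proof -
  interpret cocommutative_hopf_algebra H by fact
  show ?thesis
  proof
    fix X :: "('k, 'h, 'a, 'b) two_term" assume "X \<in> pseudoalgebras H"
    then show "\<exists>i\<in>pseudoalgebra_hom H X X.
        (\<forall>Y\<in>pseudoalgebras H. \<forall>f\<in>pseudoalgebra_hom H X Y. mor_comp H X X Y f i = f)
        \<and> (\<forall>Y\<in>pseudoalgebras H. \<forall>f\<in>pseudoalgebra_hom H Y X. mor_comp H Y X X i f = f)"
      by (intro bexI[of _ "id_mor X"])
        (auto simp: pseudoalgebras_def pseudoalgebra_hom_def mor_comp_id_left mor_comp_id_right id_mor_morphism)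
  qed (auto simp: pseudoalgebras_def pseudoalgebra_hom_def mor_comp_morphism mor_comp_assoc)
qed

end
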